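(* Let $\tau>0$ and let $(\phi^n)_{n\ge -1}\subset\mathcal{V}_{\mathrm{per}}$, with $\phi^{-1}=\phi^0$ and $\|\phi^n\|_\infty<1$ for all $n$, be a solution of the numerical scheme $$\frac{\phi^{n+1}-\phi^{n}}{\tau}=\nabla_h\cdot\big(\breve{\mathcal{M}}^{n+\frac12}\nabla_h\mu^{n+\frac12}\big),\qquad \mu^{n+\frac12}=\mu_h[\phi^{n+1},\phi^{n},\phi^{n-1}],\qquad n\ge0.$$ Define the modified energy $$\tilde{\mathcal{E}}_h(\phi,\psi)=\mathcal{E}_h(\phi)+\frac{\theta_0}{4}\|\phi-\psi\|_2^2+\frac{\varepsilon^2}{8}\|\nabla_h(\phi-\psi)\|_2^2 .$$ Then the scheme satisfies the discrete energy dissipation law $$\tilde{\mathcal{E}}_h(\phi^{n+1},\phi^{n})\le\tilde{\mathcal{E}}_h(\phi^{n},\phi^{n-1})\qquad\text{for all } n\ge0.$$ As a consequence, for all $m\in\mathbb{N}$, $$\mathcal{E}_h(\phi^m)\le\tilde{\mathcal{E}}_h(\phi^m,\phi^{m-1})\le\cdots\le\tilde{\mathcal{E}}_h(\phi^1,\phi^0)\le\tilde{\mathcal{E}}_h(\phi^0,\phi^{-1})=\mathcal{E}_h(\phi^0)\le C_3,$$ where $C_3>0$ is a constant independent of $h$.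
   Context: Grid: $\Omega=(0,L)^3$, $L>0$, $h=L/N$ with $N$ a positive integer. $\mathcal{V}_{\mathrm{per}}$ is the space of real grid functions $u=(u_{i,j,k})_{i,j,k\in\mathbb{Z}}$ on the cell centers $(p_i,p_j,p_k)$, $p_i=(i-\frac12)h$, that are $N$-periodic in each index. $\langle u,\xi\rangle_\Omega=h^3\sum_{i,j,k=1}^N u_{i,j,k}\xi_{i,j,k}$, $\|u\|_2^2=\langle u,u\rangle_\Omega$, $\|u\|_\infty=\max|u_{i,j,k}|$, $\overline{u}=|\Omega|^{-1}\langle u,1\rangle_\Omega$, $\mathring{\mathcal{V}}_{\mathrm{per}}=\{u\in\mathcal{V}_{\mathrm{per}}:\overline u=0\}$. Center-to-face operators: $A_xu_{i+\frac12,j,k}=\frac12(u_{i+1,j,k}+u_{i,j,k})$, $D_xu_{i+\frac12,j,k}=\frac1h(u_{i+1,j,k}-u_{i,j,k})$; face-to-center difference: $d_xw_{i,j,k}=\frac1h(w_{i+\frac12,j,k}-w_{i-\frac12,j,k})$; similarly in $y,z$. $\nabla_hu=(D_xu,D_yu,D_zu)$, $\nabla_h\cdot\vec w=d_xw^x+d_yw^y+d_zw^z$, $\Delta_hu=\nabla_h\cdot\nabla_hu$; $\nabla_h\cdot(g\nabla_hu)=d_x(gD_xu)+d_y(gD_yu)+d_z(gD_zu)$ for a face-centered scalar $g$. $\|\nabla_hu\|_2^2$ is $h^3$ times the sum over one period of $|D_xu|^2$, $|D_yu|^2$, $|D_zu|^2$ over the respective faces. $A_h$ denotes averaging to face-centered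 points ($A_x$ on $x$-faces, $A_y$ on $y$-faces, $A_z$ on $z$-faces). $(-\Delta_h)^{-1}$ is the inverse of $-\Delta_h$ on $\mathring{\mathcal{V}}_{\mathrm{per}}$ and $\|u\|_{-1,h}^2=\langle u,(-\Delta_h)^{-1}u\rangle_\Omega$ for $u\in\mathring{\mathcal{V}}_{\mathrm{per}}$. Parameters: $\theta_0>0$, $\varepsilon>0$, $\sigma\ge0$; $\mathcal{M}>0$ is the mobility function on $[-1,1]$. Scheme: $G(x)=x\ln x$ (with $G(0)=0$), and for grid functions $u,v,w$ (values of $u,v$ in $(-1,1)$) $$\begin{aligned}\mu_h[u,v,w]={}&\frac{G(1+u)-G(1+v)}{u-v}+\frac{G(1-u)-G(1-v)}{u-v}-\theta_0\Big(\tfrac32v-\tfrac12w\Big)-\varepsilon^2\Delta_h\Big(\tfrac34u+\tfrac14w\Big)\\&+\sigma(-\Delta_h)^{-1}\Big(\tfrac{u+v}2-\overline{\tfrac{u+v}2}\Big)+\tau\big(\ln(1+u)-\ln(1+v)-\ln(1-u)+\ln(1-v)\big),\end{aligned}$$ where the difference quotients are understood pointwise, and at points with $u=v$ as their limits $G'(1+v)$ and $-G'(1-v)$, with $G'(x)=\ln x+1$. The face-centered discrete mobility is $$\breve{\mathcal{M}}^{n+\frac12}=\Big(\big(A_h(\tfrac32\mathcal{M}(\phi^n)-\tfrac12\mathcal{M}(\phi^{n-1}))\big)^2+\tau^6\Big)^{1/2}.$$ Discrete energy: $$\mathcal{E}_h(\phi)=\langle1+\phi,\ln(1+\phi)\rangle_\Omega+\langle1-\phi,\ln(1-\phi)\rangle_\Omega-\frac{\theta_0}2\|\phi\|_2^2+\frac{\varepsilon^2}2\|\nabla_h\phi\|_2^2+\frac\sigma2\|\phi-\overline\phi\|_{-1,h}^2.$$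 Initial data (relevant only to the $h$-independence of $C_3$): $\phi^0$ is the restriction to the cell centers of the Fourier projection $\mathcal{P}_N\Phi(\cdot,0)$ (truncation to trigonometric polynomials of degree at most $K$ in each variable, $N=2K+1$) of a fixed smooth ($C^6$) $L$-periodic function $\Phi(\cdot,0)$. *)

theory Defs
  imports "HOL-Analysis.Analysis"
begin

text \<open>
  A grid function \<open>u\<close> is indexed by all integer triples; \<open>u i j k\<close> is its value at the cell center
  \<open>(p i, p j, p k)\<close> with \<open>p i = (i - 1/2) h\<close>. An array of values on the \<open>x\<close>-faces stores the value
  at \<open>(i + 1/2, j, k)\<close> under the index \<open>(i, j, k)\<close>, and likewise for \<open>y\<close>- and \<open>z\<close>-faces. A face
  field collects the arrays on the \<open>x\<close>-, \<open>y\<close>- and \<open>z\<close>-faces; it serves both for the vector fields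
  on faces and for the face-centered scalars.
\<close>

type_synonym grid = "int \<Rightarrow> int \<Rightarrow> int \<Rightarrow> real"
type_synonym face_field = "grid \<times> grid \<times> grid"

definition mesh :: "real \<Rightarrow> nat \<Rightarrow> real" where
  "mesh L N = L / real N"

definition V_per :: "nat \<Rightarrow> grid set" where
  "V_per N = {u. \<forall>i j k. u (i + int N) j k = u i j k \<and> u i (j + int N) k = u i j k
                      \<and> u i j (k + int N) = u i j k}"

definition grid_inner :: "real \<Rightarrow> nat \<Rightarrow> grid \<Rightarrow> grid \<Rightarrow> real" where
  "grid_inner L N u v =
     mesh L N ^ 3 * (\<Sum>i = 1..int N. \<Sum>j = 1..int N. \<Sum>k = 1..int N. u i j k * v i j k)"

definition norm2_sq :: "real \<Rightarrow> nat \<Rightarrow> grid \<Rightarrow> real" where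
  "norm2_sq L N u = grid_inner L N u u"

definition norm_sup :: "nat \<Rightarrow> grid \<Rightarrow> real" where
  "norm_sup N u =
     Max ((\<lambda>(i, j, k). \<bar>u i j k\<bar>) ` ({1..int N} \<times> {1..int N} \<times> {1..int N}))"

definition grid_mean :: "real \<Rightarrow> nat \<Rightarrow> grid \<Rightarrow> real" where
  "grid_mean L N u = grid_inner L N u (\<lambda>i j k. 1) / L ^ 3"

definition V0_per :: "real \<Rightarrow> nat \<Rightarrow> grid set" where
  "V0_per L N = {u \<in> V_per N. grid_mean L N u = 0}"

definition demean :: "real \<Rightarrow> nat \<Rightarrow> grid \<Rightarrow> grid" where
  "demean L N u = (\<lambda>i j k. u i j k - grid_mean L N u)"

definition A_face :: "grid \<Rightarrow> face_field" where
  "A_face u = (\<lambda>i j k. (u (i + 1) j k + u i j k) / 2,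
               \<lambda>i j k. (u i (j + 1) k + u i j k) / 2,
               \<lambda>i j k. (u i j (k + 1) + u i j k) / 2)"

definition grad_h :: "real \<Rightarrow> nat \<Rightarrow> grid \<Rightarrow> face_field" where
  "grad_h L N u = (\<lambda>i j k. (u (i + 1) j k - u i j k) / mesh L N,
                   \<lambda>i j k. (u i (j + 1) k - u i j k) / mesh L N,
                   \<lambda>i j k. (u i j (k + 1) - u i j k) / mesh L N)"

definition div_h :: "real \<Rightarrow> nat \<Rightarrow> face_field \<Rightarrow> grid" where
  "div_h L N = (\<lambda>(wx, wy, wz) i j k.
     (wx i j k - wx (i - 1) j k) / mesh L N
   + (wy i j k - wy i (j - 1) k) / mesh L N
   + (wz i j k - wz i j (k - 1)) / mesh L N)"

definition face_map :: "(real \<Rightarrow> real) \<Rightarrow> face_field \<Rightarrow> face_field" where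
  "face_map f = (\<lambda>(wx, wy, wz).
     (\<lambda>i j k. f (wx i j k), \<lambda>i j k. f (wy i j k), \<lambda>i j k. f (wz i j k)))"

definition face_mult :: "face_field \<Rightarrow> face_field \<Rightarrow> face_field" where
  "face_mult = (\<lambda>(gx, gy, gz) (wx, wy, wz).
     (\<lambda>i j k. gx i j k * wx i j k, \<lambda>i j k. gy i j k * wy i j k, \<lambda>i j k. gz i j k * wz i j k))"

definition laplace_h :: "real \<Rightarrow> nat \<Rightarrow> grid \<Rightarrow> grid" where
  "laplace_h L N u = div_h L N (grad_h L N u)"

definition grad_norm_sq :: "real \<Rightarrow> nat \<Rightarrow> grid \<Rightarrow> real" where
  "grad_norm_sq L N u = (case grad_h L N u of (wx, wy, wz) \<Rightarrow>
     mesh L N ^ 3 * (\<Sum>i = 1..int N. \<Sum>j = 1..int N. \<Sum>k = 1..int N.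
        (wx i j k)\<^sup>2 + (wy i j k)\<^sup>2 + (wz i j k)\<^sup>2))"

definition inv_neg_laplace :: "real \<Rightarrow> nat \<Rightarrow> grid \<Rightarrow> grid" where
  "inv_neg_laplace L N = the_inv_into (V0_per L N) (\<lambda>u i j k. - laplace_h L N u i j k)"

definition norm_minus1_sq :: "real \<Rightarrow> nat \<Rightarrow> grid \<Rightarrow> real" where
  "norm_minus1_sq L N u = grid_inner L N u (inv_neg_laplace L N u)"

text \<open>\<open>G\<close> satisfies \<open>G 0 = 0\<close>.\<close>

definition G :: "real \<Rightarrow> real" where
  "G x = x * ln x"

definition G' :: "real \<Rightarrow> real" where
  "G' x = ln x + 1"

definition quot_plus :: "real \<Rightarrow> real \<Rightarrow> real" where
  "quot_plus a b = (if a = b then G' (1 + b) else (G (1 + a) - G (1 + b)) / (a - b))"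

definition quot_minus :: "real \<Rightarrow> real \<Rightarrow> real" where
  "quot_minus a b = (if a = b then - G' (1 - b) else (G (1 - a) - G (1 - b)) / (a - b))"

definition chem_pot ::
  "real \<Rightarrow> nat \<Rightarrow> real \<Rightarrow> real \<Rightarrow> real \<Rightarrow> real \<Rightarrow> grid \<Rightarrow> grid \<Rightarrow> grid \<Rightarrow> grid" where
  "chem_pot L N \<theta>\<^sub>0 \<epsilon> \<sigma> \<tau> u v w = (\<lambda>i j k.
     quot_plus (u i j k) (v i j k) + quot_minus (u i j k) (v i j k)
   - \<theta>\<^sub>0 * (3/2 * v i j k - 1/2 * w i j k)
   - \<epsilon>\<^sup>2 * laplace_h L N (\<lambda>i j k. 3/4 * u i j k + 1/4 * w i j k) i j k
   + \<sigma> * inv_neg_laplace L N (demean L N (\<lambda>i j k. (u i j k + v i j k) / 2)) i j k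
   + \<tau> * (ln (1 + u i j k) - ln (1 + v i j k) - ln (1 - u i j k) + ln (1 - v i j k)))"

definition face_mobility :: "(real \<Rightarrow> real) \<Rightarrow> real \<Rightarrow> grid \<Rightarrow> grid \<Rightarrow> face_field" where
  "face_mobility M \<tau> v w = face_map (\<lambda>a. sqrt (a\<^sup>2 + \<tau> ^ 6))
     (A_face (\<lambda>i j k. 3/2 * M (v i j k) - 1/2 * M (w i j k)))"

text \<open>Time levels are indexed by \<open>int\<close>, only levels \<open>n \<ge> -1\<close> being relevant.\<close>

definition scheme_solution ::
  "real \<Rightarrow> nat \<Rightarrow> real \<Rightarrow> real \<Rightarrow> real \<Rightarrow> (real \<Rightarrow> real) \<Rightarrow> real \<Rightarrow> (int \<Rightarrow> grid) \<Rightarrow> bool" where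
  "scheme_solution L N \<theta>\<^sub>0 \<epsilon> \<sigma> M \<tau> \<phi> \<longleftrightarrow>
     (\<forall>n\<ge>-1. \<phi> n \<in> V_per N \<and> norm_sup N (\<phi> n) < 1) \<and>
     \<phi> (-1) = \<phi> 0 \<and>
     (\<forall>n\<ge>0. \<forall>i j k.
        (\<phi> (n + 1) i j k - \<phi> n i j k) / \<tau> =
        div_h L N (face_mult (face_mobility M \<tau> (\<phi> n) (\<phi> (n - 1)))
          (grad_h L N (chem_pot L N \<theta>\<^sub>0 \<epsilon> \<sigma> \<tau> (\<phi> (n + 1)) (\<phi> n) (\<phi> (n - 1))))) i j k)"

definition energy :: "real \<Rightarrow> nat \<Rightarrow> real \<Rightarrow> real \<Rightarrow> real \<Rightarrow> grid \<Rightarrow> real" where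
  "energy L N \<theta>\<^sub>0 \<epsilon> \<sigma> u =
     grid_inner L N (\<lambda>i j k. 1 + u i j k) (\<lambda>i j k. ln (1 + u i j k))
   + grid_inner L N (\<lambda>i j k. 1 - u i j k) (\<lambda>i j k. ln (1 - u i j k))
   - \<theta>\<^sub>0 / 2 * norm2_sq L N u
   + \<epsilon>\<^sup>2 / 2 * grad_norm_sq L N u
   + \<sigma> / 2 * norm_minus1_sq L N (demean L N u)"

definition mod_energy :: "real \<Rightarrow> nat \<Rightarrow> real \<Rightarrow> real \<Rightarrow> real \<Rightarrow> grid \<Rightarrow> grid \<Rightarrow> real" where
  "mod_energy L N \<theta>\<^sub>0 \<epsilon> \<sigma> u v =
     energy L N \<theta>\<^sub>0 \<epsilon> \<sigma> u
   + \<theta>\<^sub>0 / 4 * norm2_sq L N (\<lambda>i j k. u i j k - v i j k)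
   + \<epsilon>\<^sup>2 / 8 * grad_norm_sq L N (\<lambda>i j k. u i j k - v i j k)"

primrec C_diff :: "nat \<Rightarrow> (real ^ 3 \<Rightarrow> real) \<Rightarrow> bool" where
  "C_diff 0 f \<longleftrightarrow> continuous_on UNIV f"
| "C_diff (Suc n) f \<longleftrightarrow>
     (\<forall>x. f differentiable (at x)) \<and> (\<forall>v. C_diff n (\<lambda>x. frechet_derivative f (at x) v))"

definition L_periodic :: "real \<Rightarrow> (real ^ 3 \<Rightarrow> real) \<Rightarrow> bool" where
  "L_periodic L f \<longleftrightarrow> (\<forall>x i. f (x + axis i L) = f x)"

definition fourier_mode :: "real \<Rightarrow> int \<Rightarrow> int \<Rightarrow> int \<Rightarrow> real ^ 3 \<Rightarrow> complex" where
  "fourier_mode L a b c x =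
     exp (\<i> * of_real (2 * pi / L * (of_int a * x $ 1 + of_int b * x $ 2 + of_int c * x $ 3)))"

definition fourier_coeff :: "real \<Rightarrow> (real ^ 3 \<Rightarrow> real) \<Rightarrow> int \<Rightarrow> int \<Rightarrow> int \<Rightarrow> complex" where
  "fourier_coeff L f a b c =
     integral (box 0 (\<chi> i. L)) (\<lambda>x. of_real (f x) * cnj (fourier_mode L a b c x)) / of_real (L ^ 3)"

definition fourier_proj :: "real \<Rightarrow> nat \<Rightarrow> (real ^ 3 \<Rightarrow> real) \<Rightarrow> real ^ 3 \<Rightarrow> complex" where
  "fourier_proj L K f x =
     (\<Sum>a = - int K..int K. \<Sum>b = - int K..int K. \<Sum>c = - int K..int K.
        fourier_coeff L f a b c * fourier_mode L a b c x)"

definition cell_center :: "real \<Rightarrow> nat \<Rightarrow> int \<Rightarrow> int \<Rightarrow> int \<Rightarrow> real ^ 3" where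
  "cell_center L N i j k =
     vector [(of_int i - 1/2) * mesh L N, (of_int j - 1/2) * mesh L N, (of_int k - 1/2) * mesh L N]"

definition fourier_initial :: "real \<Rightarrow> nat \<Rightarrow> (real ^ 3 \<Rightarrow> real) \<Rightarrow> grid \<Rightarrow> bool" where
  "fourier_initial L N f u \<longleftrightarrow>
     (\<exists>K. N = 2 * K + 1 \<and>
          (\<forall>i j k. of_real (u i j k) = fourier_proj L K f (cell_center L N i j k)))"

end

theory Submission
  imports Defs "HOL-Library.Function_Algebras"
begin

text \<open>
  Write \<open>u\<close>, \<open>v\<close>, \<open>w\<close> for three consecutive time levels (newest first). Pairing the scheme with the
  chemical potential and summing by parts gives
  \<open>\<langle>u - v, \<mu>\<rangle> = - \<tau> \<langle>M \<nabla>\<mu>, \<nabla>\<mu>\<rangle> \<le> 0\<close>, because the face mobility is a square root and hence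
  nonnegative (\<open>mobility_flux_dissipates\<close>). On the other side, \<open>\<langle>u - v, \<mu>\<rangle>\<close> dominates the increment
  of the modified energy (\<open>mod_energy_increment_le\<close>), term by term: the difference quotients
  telescope to the increment of the entropy; the extrapolated concave term and the averaged
  gradient term differ from exact increments by completed squares, which are what the two
  correction terms of the modified energy pay for; the nonlocal term is an exact increment since
  the inverse Laplacian is symmetric; and the \<open>\<tau>\<close>-regularisation is monotone.

  The nonlocal term requires that minus the discrete Laplacian be bijective on mean-zero grid functions.
  Injectivity follows from a discrete Poincare inequality (\<open>discrete_poincare\<close>), and bijectivity
  from finite dimension (\<open>neg_laplace_bij\<close>). The constant in the Poincare inequality is
  independent of the mesh size, so it also bounds the nonlocal part of the initial energy.

  The entropy part of the initial energy is bounded because the values lie in \<open>(-1, 1)\<close>. What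
  remains is a mesh-independent bound of the discrete gradient of the projected initial datum.
  The Fourier projection commutes with translations, so the discrete gradient at the nodes is the projection of the difference quotient
  \<open>g\<close> of the continuous datum, and \<open>g\<close> is bounded by a Lipschitz constant. As there are \<open>2 K + 1\<close>
  nodes per direction, the modes of degree at most \<open>K\<close> are orthogonal over the nodes as well as
  over the cell, so the discrete \<open>L\<^sup>2\<close> norm of the projection equals its continuous one, which
  Bessel's inequality bounds by that of \<open>g\<close> (\<open>fourier_initial_gradient_bound\<close>).
\<close>

section \<open>Sums over one period\<close>

definition period_sum :: "nat \<Rightarrow> grid \<Rightarrow> real" where
  "period_sum N u = (\<Sum>i = 1..int N. \<Sum>j = 1..int N. \<Sum>k = 1..int N. u i j k)"

lemma sum_period_shift:
  fixes f :: "int \<Rightarrow> 'a::comm_monoid_add"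
  assumes "\<And>i. f (i + int N) = f i"
  shows "(\<Sum>i = 1..int N. f (i + 1)) = (\<Sum>i = 1..int N. f i)"
proof (cases "N = 0")
  case False
  have "(\<Sum>i = 1..int N. f (i + 1)) = (\<Sum>i = 2..int N + 1. f i)"
    by (rule sum.reindex_bij_witness[of _ "\<lambda>i. i - 1" "\<lambda>i. i + 1"]) auto
  also have "{2..int N + 1} = insert (int N + 1) {2..int N}"
    using False by auto
  also have "(\<Sum>i \<in> insert (int N + 1) {2..int N}. f i) = f 1 + (\<Sum>i \<in> {2..int N}. f i)"
    using assms[of 1] by (simp add: add.commute)
  also have "\<dots> = (\<Sum>i \<in> insert 1 {2..int N}. f i)"
    by simp
  also have "insert 1 {2..int N} = {1..int N}"
    using False by auto
  finally show ?thesis .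
qed simp

lemma V_perD:
  assumes "u \<in> V_per N"
  shows "u (i + int N) j k = u i j k" "u i (j + int N) k = u i j k" "u i j (k + int N) = u i j k"
  using assms by (auto simp: V_per_def)

lemma V_perI:
  assumes "\<And>i j k. u (i + int N) j k = u i j k" "\<And>i j k. u i (j + int N) k = u i j k"
    "\<And>i j k. u i j (k + int N) = u i j k"
  shows "u \<in> V_per N"
  using assms by (auto simp: V_per_def)

lemma V_per_pointwise:
  assumes "u \<in> V_per N" "v \<in> V_per N"
  shows "(\<lambda>i j k. f (u i j k) (v i j k)) \<in> V_per N"
  using assms by (auto simp: V_per_def)

lemma V_per_shift:
  assumes "u \<in> V_per N"
  shows "(\<lambda>i j k. u (i + a) (j + b) (k + c)) \<in> V_per N"
proof (rule V_perI)
  fix i j k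
  show "u (i + int N + a) (j + b) (k + c) = u (i + a) (j + b) (k + c)"
    using V_perD(1)[OF assms, of "i + a"] by (simp add: ac_simps)
  show "u (i + a) (j + int N + b) (k + c) = u (i + a) (j + b) (k + c)"
    using V_perD(2)[OF assms, of _ "j + b"] by (simp add: ac_simps)
  show "u (i + a) (j + b) (k + int N + c) = u (i + a) (j + b) (k + c)"
    using V_perD(3)[OF assms, of _ _ "k + c"] by (simp add: ac_simps)
qed

lemma period_sum_shift:
  assumes "u \<in> V_per N"
  shows "period_sum N (\<lambda>i j k. u (i + 1) j k) = period_sum N u"
    and "period_sum N (\<lambda>i j k. u i (j + 1) k) = period_sum N u"
    and "period_sum N (\<lambda>i j k. u i j (k + 1)) = period_sum N u"
proof -
  have "(\<Sum>i = 1..int N. (\<lambda>i. \<Sum>j = 1..int N. \<Sum>k = 1..int N. u i j k) (i + 1))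
      = (\<Sum>i = 1..int N. (\<lambda>i. \<Sum>j = 1..int N. \<Sum>k = 1..int N. u i j k) i)"
    by (rule sum_period_shift) (simp add: V_perD[OF assms])
  then show "period_sum N (\<lambda>i j k. u (i + 1) j k) = period_sum N u"
    by (simp add: period_sum_def)
  have "(\<Sum>j = 1..int N. (\<lambda>j. \<Sum>k = 1..int N. u i j k) (j + 1))
      = (\<Sum>j = 1..int N. (\<lambda>j. \<Sum>k = 1..int N. u i j k) j)" for i
    by (rule sum_period_shift) (simp add: V_perD[OF assms])
  then show "period_sum N (\<lambda>i j k. u i (j + 1) k) = period_sum N u"
    by (simp add: period_sum_def)
  have "(\<Sum>k = 1..int N. (\<lambda>k. u i j k) (k + 1)) = (\<Sum>k = 1..int N. (\<lambda>k. u i j k) k)" for i j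
    by (rule sum_period_shift) (simp add: V_perD[OF assms])
  then show "period_sum N (\<lambda>i j k. u i j (k + 1)) = period_sum N u"
    by (simp add: period_sum_def)
qed

lemma period_sum_add:
  "period_sum N (\<lambda>i j k. u i j k + v i j k) = period_sum N u + period_sum N v"
  by (simp add: period_sum_def sum.distrib)

lemma period_sum_diff:
  "period_sum N (\<lambda>i j k. u i j k - v i j k) = period_sum N u - period_sum N v"
  by (simp add: period_sum_def sum_subtractf)

lemma period_sum_cmult: "period_sum N (\<lambda>i j k. c * u i j k) = c * period_sum N u"
  by (simp add: period_sum_def sum_distrib_left)

lemma period_sum_uminus: "period_sum N (\<lambda>i j k. - u i j k) = - period_sum N u"
  by (simp add: period_sum_def sum_negf)

lemma period_sum_const: "period_sum N (\<lambda>i j k. c) = real N ^ 3 * c"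
  by (simp add: period_sum_def power3_eq_cube)

lemma period_sum_mono:
  assumes "\<And>i j k. i \<in> {1..int N} \<Longrightarrow> j \<in> {1..int N} \<Longrightarrow> k \<in> {1..int N} \<Longrightarrow> u i j k \<le> v i j k"
  shows "period_sum N u \<le> period_sum N v"
  unfolding period_sum_def by (intro sum_mono assms)

lemma period_sum_nonneg:
  assumes "\<And>i j k. u i j k \<ge> 0"
  shows "period_sum N u \<ge> 0"
  unfolding period_sum_def by (intro sum_nonneg assms)

lemma grid_inner_eq: "grid_inner L N u v = mesh L N ^ 3 * period_sum N (\<lambda>i j k. u i j k * v i j k)"
  by (simp add: grid_inner_def period_sum_def)

lemma grid_inner_commute: "grid_inner L N u v = grid_inner L N v u"
  by (simp add: grid_inner_eq mult.commute)

lemma grid_inner_lincomb_right: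
  "grid_inner L N u (\<lambda>i j k. a * v i j k + b * w i j k)
     = a * grid_inner L N u v + b * grid_inner L N u w"
proof -
  have "period_sum N (\<lambda>i j k. u i j k * (a * v i j k + b * w i j k))
      = period_sum N (\<lambda>i j k. a * (u i j k * v i j k) + b * (u i j k * w i j k))"
    by (simp add: algebra_simps)
  then show ?thesis
    by (simp add: grid_inner_eq period_sum_add period_sum_cmult algebra_simps)
qed

lemma grid_inner_lincomb_left:
  "grid_inner L N (\<lambda>i j k. a * v i j k + b * w i j k) u
     = a * grid_inner L N v u + b * grid_inner L N w u"
  by (simp add: grid_inner_commute[of _ _ _ u] grid_inner_lincomb_right)

lemma mesh_pos: "L > 0 \<Longrightarrow> N > 0 \<Longrightarrow> mesh L N > 0"
  by (simp add: mesh_def)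

section \<open>Summation by parts\<close>

definition face_inner :: "real \<Rightarrow> nat \<Rightarrow> face_field \<Rightarrow> face_field \<Rightarrow> real" where
  "face_inner L N = (\<lambda>(vx, vy, vz) (wx, wy, wz). mesh L N ^ 3 *
     period_sum N (\<lambda>i j k. vx i j k * wx i j k + vy i j k * wy i j k + vz i j k * wz i j k))"

definition face_per :: "nat \<Rightarrow> face_field set" where
  "face_per N = V_per N \<times> V_per N \<times> V_per N"

lemma grad_norm_sq_eq: "grad_norm_sq L N u = face_inner L N (grad_h L N u) (grad_h L N u)"
  by (simp add: grad_norm_sq_def face_inner_def grad_h_def period_sum_def power2_eq_square)

lemma grad_h_per:
  assumes "u \<in> V_per N"
  shows "grad_h L N u \<in> face_per N"
  using V_per_shift[OF assms, of 1 0 0] V_per_shift[OF assms, of 0 1 0]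
    V_per_shift[OF assms, of 0 0 1] assms
  by (auto simp: grad_h_def face_per_def V_per_def)

lemma summation_by_parts:
  assumes "w \<in> V_per N" "v \<in> V_per N"
  shows "period_sum N (\<lambda>i j k. (w i j k - w (i - 1) j k) * v i j k)
           = - period_sum N (\<lambda>i j k. w i j k * (v (i + 1) j k - v i j k))"
    and "period_sum N (\<lambda>i j k. (w i j k - w i (j - 1) k) * v i j k)
           = - period_sum N (\<lambda>i j k. w i j k * (v i (j + 1) k - v i j k))"
    and "period_sum N (\<lambda>i j k. (w i j k - w i j (k - 1)) * v i j k)
           = - period_sum N (\<lambda>i j k. w i j k * (v i j (k + 1) - v i j k))"
proof -
  have sh: "(\<lambda>i j k. w (i - 1) j k) \<in> V_per N" "(\<lambda>i j k. w i (j - 1) k) \<in> V_per N"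
    "(\<lambda>i j k. w i j (k - 1)) \<in> V_per N"
    using V_per_shift[OF assms(1), of "-1" 0 0] V_per_shift[OF assms(1), of 0 "-1" 0]
      V_per_shift[OF assms(1), of 0 0 "-1"] by simp_all
  note mult_per = V_per_pointwise[OF _ assms(2), where f = "(*)"]
  show "period_sum N (\<lambda>i j k. (w i j k - w (i - 1) j k) * v i j k)
           = - period_sum N (\<lambda>i j k. w i j k * (v (i + 1) j k - v i j k))"
    using period_sum_shift(1)[OF mult_per[OF sh(1)]]
    by (simp add: algebra_simps period_sum_diff)
  show "period_sum N (\<lambda>i j k. (w i j k - w i (j - 1) k) * v i j k)
           = - period_sum N (\<lambda>i j k. w i j k * (v i (j + 1) k - v i j k))"
    using period_sum_shift(2)[OF mult_per[OF sh(2)]]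
    by (simp add: algebra_simps period_sum_diff)
  show "period_sum N (\<lambda>i j k. (w i j k - w i j (k - 1)) * v i j k)
           = - period_sum N (\<lambda>i j k. w i j k * (v i j (k + 1) - v i j k))"
    using period_sum_shift(3)[OF mult_per[OF sh(3)]]
    by (simp add: algebra_simps period_sum_diff)
qed

text \<open>
  Summation by parts makes the discrete divergence minus the adjoint of the discrete gradient; the
  boundary terms cancel by periodicity. Both the dissipation identity and the symmetry of the
  Laplacian come from here.
\<close>

lemma div_grad_adjoint:
  assumes "w \<in> face_per N" "v \<in> V_per N"
  shows "grid_inner L N (div_h L N w) v = - face_inner L N w (grad_h L N v)"
proof -
  obtain wx wy wz where w: "w = (wx, wy, wz)" by (rule prod_cases3)
  have per: "wx \<in> V_per N" "wy \<in> V_per N" "wz \<in> V_per N"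
    using assms(1) by (auto simp: w face_per_def)
  define c where "c = 1 / mesh L N"
  have "period_sum N (\<lambda>i j k. div_h L N w i j k * v i j k) =
     c * period_sum N (\<lambda>i j k. (wx i j k - wx (i - 1) j k) * v i j k)
   + c * period_sum N (\<lambda>i j k. (wy i j k - wy i (j - 1) k) * v i j k)
   + c * period_sum N (\<lambda>i j k. (wz i j k - wz i j (k - 1)) * v i j k)"
    by (simp add: w div_h_def c_def period_sum_add[symmetric] period_sum_cmult[symmetric]
        diff_divide_distrib algebra_simps)
  also have "\<dots> = - (c * period_sum N (\<lambda>i j k. wx i j k * (v (i + 1) j k - v i j k))
   + c * period_sum N (\<lambda>i j k. wy i j k * (v i (j + 1) k - v i j k))
   + c * period_sum N (\<lambda>i j k. wz i j k * (v i j (k + 1) - v i j k)))"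
    by (simp add: summation_by_parts[OF per(1) assms(2)] summation_by_parts[OF per(2) assms(2)]
        summation_by_parts[OF per(3) assms(2)])
  also have "\<dots> = - period_sum N (\<lambda>i j k. wx i j k * ((v (i + 1) j k - v i j k) / mesh L N)
      + wy i j k * ((v i (j + 1) k - v i j k) / mesh L N)
      + wz i j k * ((v i j (k + 1) - v i j k) / mesh L N))"
    by (simp add: c_def period_sum_add[symmetric] period_sum_cmult[symmetric]
        diff_divide_distrib algebra_simps)
  finally show ?thesis
    by (simp add: grid_inner_eq face_inner_def w grad_h_def)
qed

lemma face_inner_commute: "face_inner L N v w = face_inner L N w v"
  by (simp add: face_inner_def split_beta mult.commute)

lemma div_h_per:
  assumes "w \<in> face_per N"
  shows "div_h L N w \<in> V_per N"
proof -
  obtain wx wy wz where w: "w = (wx, wy, wz)" by (rule prod_cases3)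
  have per: "wx \<in> V_per N" "wy \<in> V_per N" "wz \<in> V_per N"
    using assms(1) by (auto simp: w face_per_def)
  have "(\<lambda>i j k. wx (i - 1) j k) \<in> V_per N" "(\<lambda>i j k. wy i (j - 1) k) \<in> V_per N"
    "(\<lambda>i j k. wz i j (k - 1)) \<in> V_per N"
    using V_per_shift[OF per(1), of "-1" 0 0] V_per_shift[OF per(2), of 0 "-1" 0]
      V_per_shift[OF per(3), of 0 0 "-1"] by simp_all
  with per show ?thesis
    by (auto simp: w div_h_def V_per_def)
qed

lemma laplace_h_per: "u \<in> V_per N \<Longrightarrow> laplace_h L N u \<in> V_per N"
  unfolding laplace_h_def by (intro div_h_per grad_h_per)

lemma laplace_h_symmetric:
  assumes "u \<in> V_per N" "v \<in> V_per N"
  shows "grid_inner L N (laplace_h L N u) v = grid_inner L N u (laplace_h L N v)"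
  using div_grad_adjoint[OF grad_h_per[OF assms(1)] assms(2)]
    div_grad_adjoint[OF grad_h_per[OF assms(2)] assms(1)]
  by (simp add: laplace_h_def grid_inner_commute[of L N u] face_inner_commute)

lemma laplace_h_lincomb:
  "laplace_h L N (\<lambda>i j k. a * u i j k + b * v i j k)
     = (\<lambda>i j k. a * laplace_h L N u i j k + b * laplace_h L N v i j k)"
  by (simp add: laplace_h_def div_h_def grad_h_def fun_eq_iff diff_divide_distrib
      add_divide_distrib algebra_simps)

lemma grid_mean_eq: "grid_mean L N u = mesh L N ^ 3 * period_sum N u / L ^ 3"
  by (simp add: grid_mean_def grid_inner_eq)

lemma mean_laplace_h:
  assumes "u \<in> V_per N"
  shows "grid_mean L N (laplace_h L N u) = 0"
proof -
  have "(\<lambda>i j k. 1) \<in> V_per N" by (simp add: V_per_def)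
  from laplace_h_symmetric[OF assms this] show ?thesis
    by (simp add: grid_mean_def laplace_h_def[of _ _ "\<lambda>i j k. 1"] grad_h_def div_h_def
        grid_inner_eq period_sum_const)
qed

section \<open>A discrete Poincare inequality\<close>

text \<open>
  Telescoping along the interval and Cauchy--Schwarz. The sum on the right runs over the whole
  period, so that the bound does not depend on the endpoints.
\<close>

lemma sq_increment_le:
  fixes f :: "int \<Rightarrow> real"
  assumes "a \<in> {1..int N}" "b \<in> {1..int N}"
  shows "(f a - f b)\<^sup>2 \<le> real N * (\<Sum>l = 1..int N. (f (l + 1) - f l)\<^sup>2)"
proof -
  have tele: "f y - f x = (\<Sum>l = x..<y. f (l + 1) - f l)" if "x \<le> y" for x y
    using that
  proof (induction y rule: int_ge_induct)
    case (step y)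
    have "{x..<y + 1} = insert y {x..<y}" using step by auto
    then show ?case using step by simp
  qed simp
  have main: "\<bar>f y - f x\<bar> \<le> (\<Sum>l = 1..int N. \<bar>f (l + 1) - f l\<bar>)"
    if "x \<in> {1..int N}" "y \<in> {1..int N}" "x \<le> y" for x y
  proof -
    have "\<bar>f y - f x\<bar> \<le> (\<Sum>l = x..<y. \<bar>f (l + 1) - f l\<bar>)"
      unfolding tele[OF that(3)] by (rule sum_abs)
    also have "\<dots> \<le> (\<Sum>l = 1..int N. \<bar>f (l + 1) - f l\<bar>)"
      using that by (intro sum_mono2) auto
    finally show ?thesis .
  qed
  have "\<bar>f a - f b\<bar> \<le> (\<Sum>l = 1..int N. \<bar>f (l + 1) - f l\<bar>)"
    using main[OF assms] main[OF assms(2,1)] by (cases "a \<le> b") (auto simp: abs_minus_commute)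
  then have "(f a - f b)\<^sup>2 \<le> (\<Sum>l = 1..int N. \<bar>f (l + 1) - f l\<bar>)\<^sup>2"
    by (meson abs_ge_zero abs_le_square_iff abs_of_nonneg order_trans abs_ge_self)
  also have "\<dots> \<le> real N * (\<Sum>l = 1..int N. (f (l + 1) - f l)\<^sup>2)"
    using sum_squared_le_sum_of_squares[of "\<lambda>l. \<bar>f (l + 1) - f l\<bar>" "{1..int N}"]
    by (simp add: mult.commute)
  finally show ?thesis .
qed

lemma sq_sum3_le: "(a + b + c)\<^sup>2 \<le> 3 * (a\<^sup>2 + b\<^sup>2 + c\<^sup>2)" for a b c :: real
proof -
  have "0 \<le> (a - b)\<^sup>2 + (b - c)\<^sup>2 + (a - c)\<^sup>2" by simp
  then show ?thesis by (simp add: power2_eq_square algebra_simps)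
qed

text \<open>
  For mean zero, the squares of all differences between pairs of nodes sum to \<open>2 N\<^sup>3\<close> times the sum
  of the squares of \<open>u\<close>. Two nodes are joined by a path of three axis-parallel segments, each
  controlled by \<open>sq_increment_le\<close>. Summing over all pairs, instead of fixing one endpoint, spreads
  the segments evenly over the grid; this keeps the constant at order \<open>N\<^sup>2\<close>, as the mesh-independent
  inequality below needs.
\<close>

lemma discrete_poincare_unscaled:
  assumes "N > 0" and "period_sum N u = 0"
  shows "period_sum N (\<lambda>i j k. (u i j k)\<^sup>2) \<le> 3/2 * real N ^ 2 * period_sum N (\<lambda>i j k.
     (u (i + 1) j k - u i j k)\<^sup>2 + (u i (j + 1) k - u i j k)\<^sup>2 + (u i j (k + 1) - u i j k)\<^sup>2)"
proof -
  define X where "X = period_sum N (\<lambda>i j k. (u (i + 1) j k - u i j k)\<^sup>2)"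
  define Y where "Y = period_sum N (\<lambda>i j k. (u i (j + 1) k - u i j k)\<^sup>2)"
  define Z where "Z = period_sum N (\<lambda>i j k. (u i j (k + 1) - u i j k)\<^sup>2)"
  define Dx where "Dx j k = (\<Sum>l = 1..int N. (u (l + 1) j k - u l j k)\<^sup>2)" for j k
  define Dy where "Dy i k = (\<Sum>l = 1..int N. (u i (l + 1) k - u i l k)\<^sup>2)" for i k
  define Dz where "Dz i j = (\<Sum>l = 1..int N. (u i j (l + 1) - u i j l)\<^sup>2)" for i j
  (* The path goes from (i, j, k) via (a, j, k) and (a, b, k) to (a, b, c). *)
  have path: "(u i j k - u a b c)\<^sup>2 \<le> 3 * real N * (Dx j k + Dy a k + Dz a b)"
    if "i \<in> {1..int N}" "j \<in> {1..int N}" "k \<in> {1..int N}"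
       "a \<in> {1..int N}" "b \<in> {1..int N}" "c \<in> {1..int N}" for i j k a b c
  proof -
    have "(u i j k - u a b c)\<^sup>2
        = ((u i j k - u a j k) + (u a j k - u a b k) + (u a b k - u a b c))\<^sup>2" by simp
    also have "\<dots> \<le> 3 * ((u i j k - u a j k)\<^sup>2 + (u a j k - u a b k)\<^sup>2 + (u a b k - u a b c)\<^sup>2)"
      by (rule sq_sum3_le)
    also have "\<dots> \<le> 3 * (real N * Dx j k + real N * Dy a k + real N * Dz a b)"
      unfolding Dx_def Dy_def Dz_def
      using sq_increment_le[OF that(1,4), of "\<lambda>i. u i j k"]
        sq_increment_le[OF that(2,5), of "\<lambda>j. u a j k"]
        sq_increment_le[OF that(3,6), of "\<lambda>k. u a b k"] by simp
    finally show ?thesis by (simp add: algebra_simps)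
  qed
  have "period_sum N (\<lambda>i j k. period_sum N (\<lambda>a b c. (u i j k - u a b c)\<^sup>2))
      \<le> period_sum N (\<lambda>i j k. period_sum N (\<lambda>a b c. 3 * real N * (Dx j k + Dy a k + Dz a b)))"
    by (intro period_sum_mono path)
  also have "\<dots> = 3 * real N * (period_sum N (\<lambda>i j k. period_sum N (\<lambda>a b c. Dx j k))
      + period_sum N (\<lambda>i j k. period_sum N (\<lambda>a b c. Dy a k))
      + period_sum N (\<lambda>i j k. period_sum N (\<lambda>a b c. Dz a b)))"
    by (simp only: period_sum_add period_sum_cmult)
  (* Four of the six summation indices do not occur in each segment sum, hence the factor N^4. *)
  also have "period_sum N (\<lambda>i j k. period_sum N (\<lambda>a b c. Dx j k)) = real N ^ 4 * X"
  proof -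
    have "X = (\<Sum>j = 1..int N. \<Sum>k = 1..int N. Dx j k)"
      unfolding X_def period_sum_def Dx_def
      by (subst sum.swap, rule sum.cong[OF refl], rule sum.swap)
    then show ?thesis
      by (simp add: period_sum_const period_sum_cmult) 
        (simp add: period_sum_def sum_distrib_left[symmetric] power_numeral_reduce)
  qed
  also have "period_sum N (\<lambda>i j k. period_sum N (\<lambda>a b c. Dy a k)) = real N ^ 4 * Y"
  proof -
    have "Y = (\<Sum>a = 1..int N. \<Sum>k = 1..int N. Dy a k)"
      unfolding Y_def period_sum_def Dy_def
      by (rule sum.cong[OF refl], rule sum.swap)
    also have "\<dots> = (\<Sum>k = 1..int N. \<Sum>a = 1..int N. Dy a k)"
      by (rule sum.swap)
    finally show ?thesis
      by (simp add: period_sum_def sum_distrib_left[symmetric] power_numeral_reduce)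
  qed
  also have "period_sum N (\<lambda>i j k. period_sum N (\<lambda>a b c. Dz a b)) = real N ^ 4 * Z"
    by (simp add: period_sum_const)
      (simp add: Z_def Dz_def period_sum_def sum_distrib_left[symmetric] power_numeral_reduce)
  finally have le: "period_sum N (\<lambda>i j k. period_sum N (\<lambda>a b c. (u i j k - u a b c)\<^sup>2))
      \<le> 3 * real N ^ 5 * (X + Y + Z)"
    by (simp add: power_numeral_reduce algebra_simps)
  have sq: "(x - y)\<^sup>2 = x\<^sup>2 - 2 * x * y + y\<^sup>2" for x y :: real
    by (simp add: power2_eq_square algebra_simps)
  have "period_sum N (\<lambda>i j k. period_sum N (\<lambda>a b c. (u i j k - u a b c)\<^sup>2))
      = 2 * real N ^ 3 * period_sum N (\<lambda>i j k. (u i j k)\<^sup>2)"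
    by (simp add: sq period_sum_add period_sum_diff period_sum_cmult period_sum_const assms(2))
  with le have "2 * real N ^ 3 * period_sum N (\<lambda>i j k. (u i j k)\<^sup>2) \<le> 
      2 * real N ^ 3 * (3 / 2 * real N ^ 2 * (X + Y + Z))"
    by (simp add: power_numeral_reduce algebra_simps)
  then have "period_sum N (\<lambda>i j k. (u i j k)\<^sup>2) \<le> 3 / 2 * real N ^ 2 * (X + Y + Z)"
    by (rule mult_left_le_imp_le) (use assms in simp)
  then show ?thesis
    by (simp add: X_def Y_def Z_def period_sum_add)
qed

lemma discrete_poincare:
  assumes "L > 0" "N > 0" "grid_mean L N u = 0"
  shows "norm2_sq L N u \<le> 3/2 * L\<^sup>2 * grad_norm_sq L N u"
proof -
  let ?h = "mesh L N"
  have h: "?h > 0" using assms by (simp add: mesh_pos)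
  have z: "period_sum N u = 0" using assms h by (simp add: grid_mean_eq)
  define D where "D = period_sum N (\<lambda>i j k.
     (u (i + 1) j k - u i j k)\<^sup>2 + (u i (j + 1) k - u i j k)\<^sup>2 + (u i j (k + 1) - u i j k)\<^sup>2)"
  have "grad_norm_sq L N u = ?h ^ 3 * period_sum N (\<lambda>i j k. (1 / ?h\<^sup>2) *
     ((u (i + 1) j k - u i j k)\<^sup>2 + (u i (j + 1) k - u i j k)\<^sup>2 + (u i j (k + 1) - u i j k)\<^sup>2))"
    by (simp add: grad_norm_sq_def grad_h_def period_sum_def power_divide add_divide_distrib)
  then have g: "grad_norm_sq L N u = ?h ^ 3 * (D / ?h\<^sup>2)"
    by (simp only: period_sum_cmult D_def) simp
  have NL: "real N ^ 2 = L\<^sup>2 / ?h\<^sup>2" using assms by (simp add: mesh_def field_simps)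
  have "norm2_sq L N u = ?h ^ 3 * period_sum N (\<lambda>i j k. (u i j k)\<^sup>2)"
    by (simp add: norm2_sq_def grid_inner_eq power2_eq_square)
  also have "\<dots> \<le> ?h ^ 3 * (3/2 * real N ^ 2 * D)"
    unfolding D_def using discrete_poincare_unscaled[OF assms(2) z] h
    by (intro mult_left_mono) simp_all
  also have "\<dots> = 3/2 * L\<^sup>2 * grad_norm_sq L N u"
    by (simp add: g NL)
  finally show ?thesis .
qed

section \<open>The inverse Laplacian\<close>

text \<open>
  An injective image of a basis of \<open>W\<close> is independent and as large as the basis; a vector outside its
  span could be added, giving an independent set larger than a spanning set.
\<close>

lemma (in vector_space) inj_endomorphism_surj_on_subspace:
  assumes W: "subspace W" and F: "finite F" "W \<subseteq> span F"
    and T: "Vector_Spaces.linear scale scale T" "T ` W \<subseteq> W" "inj_on T W"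
  shows "T ` W = W"
proof -
  interpret T: Vector_Spaces.linear scale scale T by (rule T(1))
  obtain B where B: "B \<subseteq> W" "independent B" "W \<subseteq> span B"
    by (rule maximal_independent_subset)
  have WB: "span B = W" using B span_minimal[OF B(1) W] by blast
  have finB: "finite B" using independent_span_bound[OF F(1) B(2)] B F by blast
  have indT: "independent (T ` B)"
    by (rule T.independent_injective_image[OF B(2)]) (simp add: WB T(3))
  have cardT: "card (T ` B) = card B"
    using T(3) B(1) by (intro card_image) (auto intro: inj_on_subset)
  have "W \<subseteq> span (T ` B)"
  proof
    fix f assume f: "f \<in> W"
    show "f \<in> span (T ` B)"
    proof (rule ccontr)
      assume nf: "f \<notin> span (T ` B)"
      then have "independent (insert f (T ` B))" by (rule independent_insertI[OF _ indT])
      moreover have "insert f (T ` B) \<subseteq> span B" using f B T(2) WB by blast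
      ultimately have "card (insert f (T ` B)) \<le> card B"
        using independent_span_bound[OF finB] by blast
      moreover have "f \<notin> T ` B" using nf span_base by blast
      ultimately show False using finB cardT by simp
    qed
  qed
  also have "span (T ` B) = T ` W" using T.span_image[of B] WB by simp
  finally show ?thesis using T(2) by blast
qed

text \<open>
  The pointwise scaling, which with pointwise addition makes the grid functions a vector space in the
  sense of the \<open>vector_space\<close> locale.
\<close>

definition grid_scale :: "real \<Rightarrow> grid \<Rightarrow> grid" where
  "grid_scale c u = (\<lambda>i j k. c * u i j k)"

lemma vector_space_grid_scale: "vector_space grid_scale"
  by unfold_locales (simp_all add: grid_scale_def fun_eq_iff algebra_simps)

definition node_indicator :: "nat \<Rightarrow> int \<times> int \<times> int \<Rightarrow> grid" where
  "node_indicator N = (\<lambda>(a, b, c) i j k.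
     of_bool (i mod int N = a mod int N \<and> j mod int N = b mod int N \<and> k mod int N = c mod int N))"

lemma sum_grid_apply:
  "(\<Sum>x\<in>A. (f x :: grid)) i j k = (\<Sum>x\<in>A. f x i j k)"
  by (induction A rule: infinite_finite_induct) auto

text \<open>
  Reduction modulo the period: the grid functions are indexed by all integers, whereas sums and
  maxima only see one period.
\<close>

lemma periodic_mod:
  fixes f :: "int \<Rightarrow> 'a"
  assumes "\<And>i. f (i + int N) = f i"
  shows "f (i mod int N) = f i"
proof -
  have nat_steps: "f (i + int m * int N) = f i" for m i
  proof (induction m)
    case (Suc m)
    have "f (i + int (Suc m) * int N) = f (i + int m * int N + int N)" by (simp add: algebra_simps)
    then show ?case using Suc assms by simp
  qed simp
  have "f (x + m * int N) = f x" for m x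
  proof (cases "m \<ge> 0")
    case True
    then show ?thesis using nat_steps[of x "nat m"] by simp
  next
    case False
    then show ?thesis using nat_steps[of "x + m * int N" "nat (-m)"] by simp
  qed
  from this[of "i mod int N" "i div int N"] show ?thesis by simp
qed

lemma periodic_grid_in_span:
  assumes "N > 0" "u \<in> V_per N"
  shows "u \<in> module.span grid_scale
           (node_indicator N ` ({0..<int N} \<times> {0..<int N} \<times> {0..<int N}))"
proof -
  interpret vector_space grid_scale by (rule vector_space_grid_scale)
  let ?Q = "{0..<int N} \<times> {0..<int N} \<times> {0..<int N}"
  have u_mod: "u (i mod int N) (j mod int N) (k mod int N) = u i j k" for i j k
  proof -
    have "u (i mod int N) (j mod int N) (k mod int N) = u i (j mod int N) (k mod int N)"
      by (rule periodic_mod) (rule V_perD[OF assms(2)])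
    also have "\<dots> = u i j (k mod int N)"
      by (rule periodic_mod[of "\<lambda>j. u i j (k mod int N)"]) (rule V_perD[OF assms(2)])
    also have "\<dots> = u i j k"
      by (rule periodic_mod) (rule V_perD[OF assms(2)])
    finally show ?thesis .
  qed
  have "u = (\<Sum>p\<in>?Q. grid_scale (case p of (a, b, c) \<Rightarrow> u a b c) (node_indicator N p))"
    (is "_ = ?R")
  proof (intro ext)
    fix i j k
    let ?m = "(i mod int N, j mod int N, k mod int N)"
    have m: "?m \<in> ?Q" using assms by simp
    have "?R i j k = (\<Sum>p\<in>?Q. if p = ?m then u i j k else 0)"
      unfolding sum_grid_apply
    proof (rule sum.cong[OF refl])
      fix p assume p: "p \<in> ?Q"
      obtain a b c where abc: "p = (a, b, c)" by (rule prod_cases3)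
      show "grid_scale (case p of (a, b, c) \<Rightarrow> u a b c) (node_indicator N p) i j k
          = (if p = ?m then u i j k else 0)"
        using p u_mod[of i j k] by (auto simp: abc grid_scale_def node_indicator_def)
    qed
    also have "\<dots> = u i j k" using m by (subst sum.delta) auto
    finally show "u i j k = ?R i j k" by simp
  qed
  moreover have "?R \<in> span (node_indicator N ` ?Q)"
    by (intro span_sum span_scale span_base imageI)
  ultimately show ?thesis by simp
qed

lemma V0_per_iff:
  assumes "L > 0" "N > 0"
  shows "u \<in> V0_per L N \<longleftrightarrow> u \<in> V_per N \<and> period_sum N u = 0"
  using assms mesh_pos[OF assms] by (simp add: V0_per_def grid_mean_eq)

lemma V0_per_lincomb:
  assumes "L > 0" "N > 0" "u \<in> V0_per L N" "v \<in> V0_per L N"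
  shows "(\<lambda>i j k. a * u i j k + b * v i j k) \<in> V0_per L N"
  using assms(3,4) V_per_pointwise[of u N v "\<lambda>x y. a * x + b * y"]
  by (simp add: V0_per_iff[OF assms(1,2)] period_sum_add period_sum_cmult)

lemma grad_norm_sq_eq_laplace:
  assumes "u \<in> V_per N"
  shows "grad_norm_sq L N u = grid_inner L N (\<lambda>i j k. - laplace_h L N u i j k) u"
  using div_grad_adjoint[OF grad_h_per[OF assms] assms]
  by (simp add: grad_norm_sq_eq laplace_h_def grid_inner_eq period_sum_uminus)

lemma grad_norm_sq_nonneg: "L > 0 \<Longrightarrow> grad_norm_sq L N u \<ge> 0"
  by (cases "N = 0") (auto simp: grad_norm_sq_def grad_h_def mesh_def intro!: mult_nonneg_nonneg sum_nonneg)

lemma norm2_sq_nonneg: "L > 0 \<Longrightarrow> norm2_sq L N u \<ge> 0"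
  by (cases "N = 0") (auto simp: norm2_sq_def grid_inner_eq mesh_def power2_eq_square[symmetric]
      intro!: mult_nonneg_nonneg period_sum_nonneg)

lemma periodic_representative:
  assumes "N > 0" "u \<in> V_per N"
  shows "\<exists>a\<in>{1..int N}. \<exists>b\<in>{1..int N}. \<exists>c\<in>{1..int N}. u i j k = u a b c"
proof -
  define r where "r x = (x - 1) mod int N + 1" for x
  have "0 \<le> (x - 1) mod int N" "(x - 1) mod int N < int N" for x
    using assms(1) by simp_all
  then have r: "r x \<in> {1..int N}" for x
    using zless_imp_add1_zle by (fastforce simp: r_def)
  have per: "f (r x) = f x" if "\<And>x. f (x + int N) = f x" for f :: "int \<Rightarrow> real" and x
    using periodic_mod[of "\<lambda>x. f (x + 1)" N "x - 1"] that[of "_ + 1"]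
    by (simp add: r_def algebra_simps)
  have "u i j k = u (r i) j k"
    by (rule per[of "\<lambda>i. u i j k", symmetric]) (rule V_perD[OF assms(2)])
  also have "\<dots> = u (r i) (r j) k"
    by (rule per[of "\<lambda>j. u (r i) j k", symmetric]) (rule V_perD[OF assms(2)])
  also have "\<dots> = u (r i) (r j) (r k)"
    by (rule per[of "\<lambda>k. u (r i) (r j) k", symmetric]) (rule V_perD[OF assms(2)])
  finally show ?thesis using r by blast
qed

lemma norm2_sq_zero_imp:
  assumes "L > 0" "N > 0" "u \<in> V_per N" "norm2_sq L N u \<le> 0"
  shows "u = (\<lambda>i j k. 0)"
proof (intro ext)
  fix i j k
  have "period_sum N (\<lambda>i j k. (u i j k)\<^sup>2) \<le> 0"
    using assms(4) mesh_pos[OF assms(1,2)]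
    by (simp add: norm2_sq_def grid_inner_eq power2_eq_square mult_le_0_iff)
  then have "period_sum N (\<lambda>i j k. (u i j k)\<^sup>2) = 0"
    by (intro order_antisym period_sum_nonneg) auto
  then have "\<forall>a\<in>{1..int N}. \<forall>b\<in>{1..int N}. \<forall>c\<in>{1..int N}. u a b c = 0"
    by (simp add: period_sum_def sum_nonneg_eq_0_iff sum_nonneg)
  then show "u i j k = 0" using periodic_representative[OF assms(2,3)] by metis
qed

text \<open>
  A mean-zero grid function in the kernel has zero gradient, since \<open>\<langle>- \<Delta> d, d\<rangle>\<close> is its squared
  gradient norm, and so vanishes by the Poincare inequality. In finite dimension injectivity is enough.
\<close>

lemma neg_laplace_bij:
  assumes "L > 0" "N > 0"
  shows "bij_betw (\<lambda>u i j k. - laplace_h L N u i j k) (V0_per L N) (V0_per L N)"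
proof -
  interpret vector_space grid_scale by (rule vector_space_grid_scale)
  let ?T = "\<lambda>u i j k. - laplace_h L N u i j k" and ?W = "V0_per L N"
  let ?F = "node_indicator N ` ({0..<int N} \<times> {0..<int N} \<times> {0..<int N})"
  have lin: "Vector_Spaces.linear grid_scale grid_scale ?T"
    using laplace_h_lincomb[of L N 1 _ 1] laplace_h_lincomb[of L N _ _ 0]
    by (auto simp: Vector_Spaces.linear_iff vector_space_grid_scale grid_scale_def plus_fun_def fun_eq_iff)
  have sub: "subspace ?W"
    using V0_per_lincomb[OF assms, of _ _ 1 1] V0_per_lincomb[OF assms, of _ _ _ 0]
    by (auto simp: subspace_def grid_scale_def plus_fun_def zero_fun_def V0_per_iff[OF assms]
        V_per_def period_sum_const)
  have into: "?T ` ?W \<subseteq> ?W"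
  proof
    fix f assume "f \<in> ?T ` ?W"
    then obtain u where u: "u \<in> ?W" "f = ?T u" by auto
    then have "u \<in> V_per N" by (simp add: V0_per_def)
    then have "laplace_h L N u \<in> ?W"
      using laplace_h_per mean_laplace_h by (simp add: V0_per_def)
    from V0_per_lincomb[OF assms this this, of "-1" 0] show "f \<in> ?W" by (simp add: u)
  qed
  have inj: "inj_on ?T ?W"
  proof (rule inj_onI)
    fix u v assume uv: "u \<in> ?W" "v \<in> ?W" "?T u = ?T v"
    define d where "d = (\<lambda>i j k. 1 * u i j k + (- 1) * v i j k)"
    have d: "d \<in> ?W" unfolding d_def by (rule V0_per_lincomb[OF assms uv(1,2)])
    then have per: "d \<in> V_per N" by (simp add: V0_per_def)
    have "laplace_h L N d = (\<lambda>i j k. 0)"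
      using uv(3) unfolding d_def laplace_h_lincomb by (simp add: fun_eq_iff)
    then have "grad_norm_sq L N d = 0"
      by (simp add: grad_norm_sq_eq_laplace[OF per] grid_inner_eq period_sum_const)
    with discrete_poincare[OF assms, of d] d have "norm2_sq L N d \<le> 0"
      by (simp add: V0_per_def)
    from norm2_sq_zero_imp[OF assms per this] show "u = v"
      by (simp add: d_def fun_eq_iff)
  qed
  have "?W \<subseteq> span ?F" using periodic_grid_in_span[OF assms(2)] by (auto simp: V0_per_def)
  from inj_endomorphism_surj_on_subspace[OF sub _ this lin into inj] inj
  show ?thesis by (simp add: bij_betw_def)
qed

lemma inv_neg_laplace:
  assumes "L > 0" "N > 0" "f \<in> V0_per L N"
  shows "inv_neg_laplace L N f \<in> V0_per L N"
    and "laplace_h L N (inv_neg_laplace L N f) = (\<lambda>i j k. - f i j k)"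
proof -
  note bij = neg_laplace_bij[OF assms(1,2)]
  show "inv_neg_laplace L N f \<in> V0_per L N"
    unfolding inv_neg_laplace_def
    using bij assms(3) by (metis (no_types, lifting) bij_betw_def order_refl the_inv_into_into)
  have "(\<lambda>i j k. - laplace_h L N (inv_neg_laplace L N f) i j k) = f"
    unfolding inv_neg_laplace_def
    using f_the_inv_into_f[of "\<lambda>u i j k. - laplace_h L N u i j k" "V0_per L N" f] bij assms(3) by (simp add: bij_betw_def)
  then show "laplace_h L N (inv_neg_laplace L N f) = (\<lambda>i j k. - f i j k)"
    by (simp add: fun_eq_iff) (metis minus_minus)
qed

lemma inv_neg_laplace_eqI:
  assumes "L > 0" "N > 0" "u \<in> V0_per L N" "laplace_h L N u = (\<lambda>i j k. - f i j k)"
  shows "inv_neg_laplace L N f = u"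
  using the_inv_into_f_f[of "\<lambda>u i j k. - laplace_h L N u i j k" "V0_per L N" u] neg_laplace_bij[OF assms(1,2)] assms(3,4)
  by (auto simp: inv_neg_laplace_def bij_betw_def)

lemma inv_neg_laplace_lincomb:
  assumes "L > 0" "N > 0" "f \<in> V0_per L N" "g \<in> V0_per L N"
  shows "inv_neg_laplace L N (\<lambda>i j k. a * f i j k + b * g i j k)
    = (\<lambda>i j k. a * inv_neg_laplace L N f i j k + b * inv_neg_laplace L N g i j k)"
  by (rule inv_neg_laplace_eqI[OF assms(1,2)])
    (simp_all add: V0_per_lincomb[OF assms(1,2)] inv_neg_laplace[OF assms(1,2)] assms(3,4)
      laplace_h_lincomb)

lemma inv_neg_laplace_symmetric:
  assumes "L > 0" "N > 0" "f \<in> V0_per L N" "g \<in> V0_per L N"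
  shows "grid_inner L N f (inv_neg_laplace L N g) = grid_inner L N (inv_neg_laplace L N f) g"
proof -
  let ?u = "inv_neg_laplace L N f" and ?v = "inv_neg_laplace L N g"
  have per: "?u \<in> V_per N" "?v \<in> V_per N"
    using inv_neg_laplace(1)[OF assms(1,2)] assms(3,4) by (auto simp: V0_per_def)
  from laplace_h_symmetric[OF this, of L]
  show ?thesis
    by (simp add: inv_neg_laplace(2)[OF assms(1,2)] assms(3,4) grid_inner_eq period_sum_uminus)
qed

text \<open>
  With \<open>u\<close> the inverse Laplacian of \<open>f\<close>, the Poincare inequality for \<open>u\<close> reads
  \<open>\<parallel>u\<parallel>\<^sup>2 \<le> c \<langle>f, u\<rangle>\<close> with \<open>c = 3/2 L\<^sup>2\<close>. Expanding \<open>0 \<le> \<parallel>c f - u\<parallel>\<^sup>2\<close> then gives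
  \<open>\<langle>f, u\<rangle> \<le> c \<parallel>f\<parallel>\<^sup>2\<close> without square roots.
\<close>

lemma norm_minus1_sq_le:
  assumes "L > 0" "N > 0" "f \<in> V0_per L N"
  shows "norm_minus1_sq L N f \<le> 3/2 * L\<^sup>2 * norm2_sq L N f"
proof -
  let ?u = "inv_neg_laplace L N f" and ?c = "3/2 * L\<^sup>2"
  have V0: "?u \<in> V0_per L N" by (rule inv_neg_laplace(1)[OF assms])
  then have per: "?u \<in> V_per N" by (simp add: V0_per_def)
  have "grad_norm_sq L N ?u = grid_inner L N f ?u"
    by (simp add: grad_norm_sq_eq_laplace[OF per] inv_neg_laplace(2)[OF assms])
  then have P: "norm2_sq L N ?u \<le> ?c * grid_inner L N f ?u"
    using discrete_poincare[OF assms(1,2), of ?u] V0 by (simp add: V0_per_def)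
  have "0 \<le> norm2_sq L N (\<lambda>i j k. ?c * f i j k + (-1) * ?u i j k)"
    using assms(1) by (rule norm2_sq_nonneg)
  also have "\<dots> = ?c\<^sup>2 * norm2_sq L N f - 2 * ?c * grid_inner L N f ?u + norm2_sq L N ?u"
    unfolding norm2_sq_def grid_inner_lincomb_left grid_inner_lincomb_right
    by (simp add: grid_inner_commute[of L N ?u f] power2_eq_square algebra_simps)
  also have "\<dots> \<le> ?c * (?c * norm2_sq L N f - grid_inner L N f ?u)"
    using P by (simp add: power2_eq_square algebra_simps)
  finally show ?thesis
    using assms(1) by (simp add: norm_minus1_sq_def zero_le_mult_iff)
qed

section \<open>Energy dissipation\<close>

lemma norm_sup_less_imp:
  assumes "N > 0" "u \<in> V_per N" "norm_sup N u < c"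
  shows "\<bar>u i j k\<bar> < c"
proof -
  obtain a b d where r: "a \<in> {1..int N}" "b \<in> {1..int N}" "d \<in> {1..int N}" "u i j k = u a b d"
    using periodic_representative[OF assms(1,2)] by blast
  have "\<bar>u a b d\<bar> \<le> norm_sup N u"
    unfolding norm_sup_def using r by (intro Max_ge) (auto intro!: rev_image_eqI[of "(a, b, d)"])
  then show ?thesis using r assms(3) by simp
qed

text \<open>
  The convex part of the chemical potential is a discrete variational derivative: multiplied by the
  increment it gives the exact difference of the entropy. In the case \<open>a = b\<close>, where the quotients
  are replaced by limits, both sides vanish.
\<close>

lemma quotient_mult_increment:
  "(quot_plus a b + quot_minus a b) * (a - b)
     = (G (1 + a) + G (1 - a)) - (G (1 + b) + G (1 - b))"
  by (simp add: quot_plus_def quot_minus_def add_divide_distrib[symmetric])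

lemma log_terms_monotone:
  fixes a b :: real
  assumes "\<bar>a\<bar> < 1" "\<bar>b\<bar> < 1"
  shows "(ln (1 + a) - ln (1 + b) - ln (1 - a) + ln (1 - b)) * (a - b) \<ge> 0"
proof (cases "a \<ge> b")
  case True
  then have "ln (1 + b) \<le> ln (1 + a)" "ln (1 - a) \<le> ln (1 - b)" using assms by auto
  with True show ?thesis by (intro mult_nonneg_nonneg) auto
next
  case False
  then have "ln (1 + a) \<le> ln (1 + b)" "ln (1 - b) \<le> ln (1 - a)" using assms by auto
  with False show ?thesis by (intro mult_nonpos_nonpos) auto
qed

text \<open>
  With \<open>x = a - b\<close> and \<open>y = b - c\<close>, the left side is \<open>- (a\<^sup>2 - b\<^sup>2)/2 + x\<^sup>2/2 - x y/2\<close>, and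
  \<open>x y \<le> (x\<^sup>2 + y\<^sup>2)/2\<close>. The remainder \<open>(x - y)\<^sup>2/4\<close> is the square in the proof.
\<close>

lemma adams_bashforth_bound:
  fixes a b c :: real
  shows "- (3/2 * b - 1/2 * c) * (a - b)
    \<ge> - (a\<^sup>2 - b\<^sup>2) / 2 + (a - b)\<^sup>2 / 4 - (b - c)\<^sup>2 / 4"
proof -
  have "0 \<le> (a - 2 * b + c)\<^sup>2 / 4" by simp
  then show ?thesis
    by (simp add: power2_eq_square field_simps)
qed

text \<open>
  The average is \<open>(a + b)/2 + (x - y)/4\<close> with \<open>x = a - b\<close> and \<open>y = b - c\<close>; its product with \<open>x\<close> is
  \<open>(a\<^sup>2 - b\<^sup>2)/2 + (x\<^sup>2 - x y)/4\<close>, and \<open>x y \<le> (x\<^sup>2 + y\<^sup>2)/2\<close>.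
\<close>

lemma adams_moulton_bound:
  fixes a b c :: real
  shows "(3/4 * a + 1/4 * c) * (a - b) \<ge> (a\<^sup>2 - b\<^sup>2) / 2 + (a - b)\<^sup>2 / 8 - (b - c)\<^sup>2 / 8"
proof -
  have "0 \<le> (a - 2 * b + c)\<^sup>2 / 8" by simp
  then show ?thesis
    by (simp add: power2_eq_square field_simps)
qed

lemma demean_per: "u \<in> V_per N \<Longrightarrow> demean L N u \<in> V_per N"
  by (simp add: demean_def V_per_def)

lemma demean_V0:
  assumes "L > 0" "N > 0" "u \<in> V_per N"
  shows "demean L N u \<in> V0_per L N"
proof -
  have "real N * mesh L N = L" using assms by (simp add: mesh_def)
  then have "real N ^ 3 * mesh L N ^ 3 = L ^ 3" by (metis power_mult_distrib)
  moreover have "real N ^ 3 * grid_mean L N u = real N ^ 3 * mesh L N ^ 3 / L ^ 3 * period_sum N u"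
    by (simp add: grid_mean_eq)
  ultimately have "real N ^ 3 * grid_mean L N u = period_sum N u" using assms by simp
  then show ?thesis
    using demean_per[OF assms(3)]
    by (simp add: V0_per_iff[OF assms(1,2)])
      (simp add: demean_def period_sum_diff period_sum_const)
qed

text \<open>
  The test function \<open>u - v\<close> may be replaced by the difference of the demeaned functions, as the inverse
  Laplacian takes values of mean zero and so annihilates constants. The mixed terms then cancel by
  symmetry, which leaves the exact increment.
\<close>

lemma nonlocal_test:
  assumes "L > 0" "N > 0" "u \<in> V_per N" "v \<in> V_per N"
  shows "grid_inner L N (\<lambda>i j k. u i j k - v i j k)
           (inv_neg_laplace L N (demean L N (\<lambda>i j k. (u i j k + v i j k) / 2)))
    = (norm_minus1_sq L N (demean L N u) - norm_minus1_sq L N (demean L N v)) / 2"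
proof -
  let ?T = "inv_neg_laplace L N"
  define f where "f = demean L N u"
  define g where "g = demean L N v"
  have V0: "f \<in> V0_per L N" "g \<in> V0_per L N"
    unfolding f_def g_def using demean_V0 assms by auto
  have "grid_mean L N (\<lambda>i j k. (u i j k + v i j k) / 2) = (grid_mean L N u + grid_mean L N v) / 2"
    using period_sum_cmult[of N "1/2" "\<lambda>i j k. u i j k + v i j k"]
    by (simp add: grid_mean_eq period_sum_add distrib_left add_divide_distrib)
  then have "demean L N (\<lambda>i j k. (u i j k + v i j k) / 2) = (\<lambda>i j k. 1/2 * f i j k + 1/2 * g i j k)"
    by (simp add: demean_def f_def g_def fun_eq_iff field_simps)
  then have T: "?T (demean L N (\<lambda>i j k. (u i j k + v i j k) / 2))
      = (\<lambda>i j k. 1/2 * ?T f i j k + 1/2 * ?T g i j k)"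
    by (simp only: inv_neg_laplace_lincomb[OF assms(1,2) V0])
  define q where "q = (\<lambda>i j k. 1/2 * ?T f i j k + 1/2 * ?T g i j k)"
  have "q \<in> V0_per L N"
    unfolding q_def by (intro V0_per_lincomb inv_neg_laplace assms V0)
  then have q0: "grid_inner L N (\<lambda>i j k. c) q = 0" for c
    by (simp add: V0_per_iff[OF assms(1,2)] grid_inner_eq period_sum_cmult)
  let ?c = "grid_mean L N u - grid_mean L N v"
  have "(\<lambda>i j k. u i j k - v i j k)
     = (\<lambda>i j k. 1 * (1 * f i j k + (- 1) * g i j k) + 1 * ?c)"
    by (simp add: f_def g_def demean_def fun_eq_iff)
  then have "grid_inner L N (\<lambda>i j k. u i j k - v i j k) q = grid_inner L N f q - grid_inner L N g q"
    using q0 by (simp only: grid_inner_lincomb_left) simp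
  also have "\<dots> = (grid_inner L N f (?T f) - grid_inner L N g (?T g)) / 2
      + (grid_inner L N f (?T g) - grid_inner L N g (?T f)) / 2"
    unfolding q_def grid_inner_lincomb_right by (simp add: field_simps)
  also have "grid_inner L N f (?T g) = grid_inner L N g (?T f)"
    using inv_neg_laplace_symmetric[OF assms(1,2) V0] by (simp add: grid_inner_commute)
  finally show ?thesis
    unfolding T q_def[symmetric] by (simp add: norm_minus1_sq_def f_def g_def)
qed

text \<open>
  After summation by parts the claim is \<open>adams_moulton_bound\<close> on every face.
\<close>

lemma gradient_test:
  assumes "L > 0" "N > 0" "u \<in> V_per N" "v \<in> V_per N" "w \<in> V_per N"
  shows "grid_inner L N (\<lambda>i j k. u i j k - v i j k)
           (\<lambda>i j k. - laplace_h L N (\<lambda>i j k. 3/4 * u i j k + 1/4 * w i j k) i j k)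
    \<ge> (grad_norm_sq L N u - grad_norm_sq L N v) / 2
      + grad_norm_sq L N (\<lambda>i j k. u i j k - v i j k) / 8
      - grad_norm_sq L N (\<lambda>i j k. v i j k - w i j k) / 8"
proof -
  let ?d = "\<lambda>i j k. u i j k - v i j k" and ?e = "\<lambda>i j k. v i j k - w i j k"
  let ?z = "\<lambda>i j k. 3/4 * u i j k + 1/4 * w i j k"
  have z: "?z \<in> V_per N" and d: "?d \<in> V_per N"
    using V_per_pointwise[OF assms(3,5), of "\<lambda>x y. 3/4 * x + 1/4 * y"]
      V_per_pointwise[OF assms(3,4), of "\<lambda>x y. x - y"] by auto
  define X where "X q = (\<lambda>i j k. (q (i + 1) j k - q i j k) / mesh L N)" for q :: grid
  define Y where "Y q = (\<lambda>i j k. (q i (j + 1) k - q i j k) / mesh L N)" for q :: grid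
  define Z where "Z q = (\<lambda>i j k. (q i j (k + 1) - q i j k) / mesh L N)" for q :: grid
  note D = X_def Y_def Z_def
  have g: "grad_norm_sq L N q = mesh L N ^ 3 * period_sum N (\<lambda>i j k.
      (X q i j k)\<^sup>2 + (Y q i j k)\<^sup>2 + (Z q i j k)\<^sup>2)" for q
    by (simp add: grad_norm_sq_eq face_inner_def grad_h_def D power2_eq_square)
  have lin: "F ?d i j k = F u i j k - F v i j k" "F ?e i j k = F v i j k - F w i j k"
    "F ?z i j k = 3/4 * F u i j k + 1/4 * F w i j k"
    if "F \<in> {X, Y, Z}" for F i j k
    using that by (auto simp: D diff_divide_distrib add_divide_distrib algebra_simps)
  have "(grad_norm_sq L N u - grad_norm_sq L N v) / 2
      + grad_norm_sq L N ?d / 8 - grad_norm_sq L N ?e / 8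
    = mesh L N ^ 3 * ((1/2) * (period_sum N (\<lambda>i j k.
      (X u i j k)\<^sup>2 + (Y u i j k)\<^sup>2 + (Z u i j k)\<^sup>2) - period_sum N (\<lambda>i j k.
      (X v i j k)\<^sup>2 + (Y v i j k)\<^sup>2 + (Z v i j k)\<^sup>2)) + (1/8) * period_sum N (\<lambda>i j k.
      (X ?d i j k)\<^sup>2 + (Y ?d i j k)\<^sup>2 + (Z ?d i j k)\<^sup>2) - (1/8) * period_sum N (\<lambda>i j k.
      (X ?e i j k)\<^sup>2 + (Y ?e i j k)\<^sup>2 + (Z ?e i j k)\<^sup>2))"
    unfolding g by (simp add: field_simps)
  also have "\<dots> = mesh L N ^ 3 * period_sum N (\<lambda>i j k.
       (1/2) * (((X u i j k)\<^sup>2 + (Y u i j k)\<^sup>2 + (Z u i j k)\<^sup>2)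
              - ((X v i j k)\<^sup>2 + (Y v i j k)\<^sup>2 + (Z v i j k)\<^sup>2))
     + (1/8) * ((X ?d i j k)\<^sup>2 + (Y ?d i j k)\<^sup>2 + (Z ?d i j k)\<^sup>2)
     - (1/8) * ((X ?e i j k)\<^sup>2 + (Y ?e i j k)\<^sup>2 + (Z ?e i j k)\<^sup>2))"
    by (simp only: period_sum_add period_sum_diff period_sum_cmult)
  also have "\<dots> \<le> mesh L N ^ 3 * period_sum N (\<lambda>i j k.
      X ?z i j k * X ?d i j k + Y ?z i j k * Y ?d i j k + Z ?z i j k * Z ?d i j k)"
  proof (intro mult_left_mono period_sum_mono)
    fix i j k
    have "(3/4 * F u i j k + 1/4 * F w i j k) * (F u i j k - F v i j k)
      \<ge> ((F u i j k)\<^sup>2 - (F v i j k)\<^sup>2) / 2 + (F u i j k - F v i j k)\<^sup>2 / 8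
         - (F v i j k - F w i j k)\<^sup>2 / 8" for F :: "grid \<Rightarrow> grid"
      by (rule adams_moulton_bound)
    from this[of X] this[of Y] this[of Z]
    show "(1/2) * (((X u i j k)\<^sup>2 + (Y u i j k)\<^sup>2 + (Z u i j k)\<^sup>2)
              - ((X v i j k)\<^sup>2 + (Y v i j k)\<^sup>2 + (Z v i j k)\<^sup>2))
     + (1/8) * ((X ?d i j k)\<^sup>2 + (Y ?d i j k)\<^sup>2 + (Z ?d i j k)\<^sup>2)
     - (1/8) * ((X ?e i j k)\<^sup>2 + (Y ?e i j k)\<^sup>2 + (Z ?e i j k)\<^sup>2)
     \<le> X ?z i j k * X ?d i j k + Y ?z i j k * Y ?d i j k + Z ?z i j k * Z ?d i j k"
      unfolding lin[of X, OF insertI1] lin[of Y, OF insertI2[OF insertI1]]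
        lin[of Z, OF insertI2[OF insertI2[OF insertI1]]] by argo
  qed (use mesh_pos[OF assms(1,2)] in simp)
  also have "\<dots> = face_inner L N (grad_h L N ?z) (grad_h L N ?d)"
    by (simp add: face_inner_def grad_h_def D)
  also have "\<dots> = grid_inner L N ?d (\<lambda>i j k. - laplace_h L N ?z i j k)"
    using div_grad_adjoint[OF grad_h_per[OF z] d, of L L]
      grid_inner_lincomb_right[of L N ?d "- 1" "laplace_h L N ?z" 0 "laplace_h L N ?z"]
    by (simp add: laplace_h_def grid_inner_commute[of L N ?d])
  finally show ?thesis .
qed

lemma energy_eq:
  "energy L N \<theta> \<epsilon> \<sigma> u =
     mesh L N ^ 3 * period_sum N (\<lambda>i j k. G (1 + u i j k) + G (1 - u i j k))
   - \<theta> / 2 * norm2_sq L N u + \<epsilon>\<^sup>2 / 2 * grad_norm_sq L N u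
   + \<sigma> / 2 * norm_minus1_sq L N (demean L N u)"
  by (simp add: energy_def grid_inner_eq G_def period_sum_add distrib_left)

lemma norm2_sq_eq: "norm2_sq L N u = mesh L N ^ 3 * period_sum N (\<lambda>i j k. (u i j k)\<^sup>2)"
  by (simp add: norm2_sq_def grid_inner_eq power2_eq_square)

text \<open>
  The chemical potential is split into its pointwise terms \<open>A\<close>, the gradient term \<open>B\<close> and the nonlocal
  term \<open>C\<close>. The squares of \<open>e = v - w\<close> lost in \<open>A\<close> and \<open>B\<close> are exactly those in the modified energy
  of the previous step, and the squares of \<open>d = u - v\<close> gained are those in the new one.
\<close>

lemma mod_energy_increment_le:
  assumes "L > 0" "N > 0" "\<theta> > 0" "\<tau> > 0"
    and per: "u \<in> V_per N" "v \<in> V_per N" "w \<in> V_per N"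
    and bd: "\<And>i j k. \<bar>u i j k\<bar> < 1" "\<And>i j k. \<bar>v i j k\<bar> < 1"
  shows "mod_energy L N \<theta> \<epsilon> \<sigma> u v - mod_energy L N \<theta> \<epsilon> \<sigma> v w
    \<le> grid_inner L N (\<lambda>i j k. u i j k - v i j k) (chem_pot L N \<theta> \<epsilon> \<sigma> \<tau> u v w)"
proof -
  let ?H = "mesh L N ^ 3"
  define d where "d = (\<lambda>i j k. u i j k - v i j k)"
  define e where "e = (\<lambda>i j k. v i j k - w i j k)"
  define A where "A = (\<lambda>i j k. quot_plus (u i j k) (v i j k) + quot_minus (u i j k) (v i j k)
     - \<theta> * (3/2 * v i j k - 1/2 * w i j k)
     + \<tau> * (ln (1 + u i j k) - ln (1 + v i j k) - ln (1 - u i j k) + ln (1 - v i j k)))"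
  define B where "B = (\<lambda>i j k. - laplace_h L N (\<lambda>i j k. 3/4 * u i j k + 1/4 * w i j k) i j k)"
  define C where "C = inv_neg_laplace L N (demean L N (\<lambda>i j k. (u i j k + v i j k) / 2))"
  have chem: "chem_pot L N \<theta> \<epsilon> \<sigma> \<tau> u v w
      = (\<lambda>i j k. 1 * A i j k + 1 * (\<epsilon>\<^sup>2 * B i j k + \<sigma> * C i j k))"
    by (simp add: chem_pot_def A_def B_def C_def fun_eq_iff)
  have H: "?H > 0" using mesh_pos[OF assms(1,2)] by simp
  have "?H * (period_sum N (\<lambda>i j k. G (1 + u i j k) + G (1 - u i j k))
            - period_sum N (\<lambda>i j k. G (1 + v i j k) + G (1 - v i j k)))
      - \<theta> / 2 * (norm2_sq L N u - norm2_sq L N v)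
      + \<theta> / 4 * norm2_sq L N d - \<theta> / 4 * norm2_sq L N e
    = ?H * period_sum N (\<lambda>i j k. ((G (1 + u i j k) + G (1 - u i j k))
        - (G (1 + v i j k) + G (1 - v i j k)))
      - (\<theta> / 2) * ((u i j k)\<^sup>2 - (v i j k)\<^sup>2) + (\<theta> / 4) * (d i j k)\<^sup>2 - (\<theta> / 4) * (e i j k)\<^sup>2)"
    unfolding norm2_sq_eq period_sum_add period_sum_diff period_sum_cmult
    by (simp add: algebra_simps)
  also have "\<dots> \<le> ?H * period_sum N (\<lambda>i j k. d i j k * A i j k)"
  proof (intro mult_left_mono period_sum_mono)
    fix i j k
    let ?a = "u i j k" and ?b = "v i j k" and ?c = "w i j k"
    have 1: "\<theta> * (- (3/2 * ?b - 1/2 * ?c) * (?a - ?b))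
        \<ge> \<theta> * (- (?a\<^sup>2 - ?b\<^sup>2) / 2 + (?a - ?b)\<^sup>2 / 4 - (?b - ?c)\<^sup>2 / 4)"
      using assms(3) adams_bashforth_bound by (intro mult_left_mono) auto
    have 2: "0 \<le> \<tau> * ((ln (1 + ?a) - ln (1 + ?b) - ln (1 - ?a) + ln (1 - ?b)) * (?a - ?b))"
      using assms(4) log_terms_monotone[OF bd] by simp
    have "d i j k * A i j k = (quot_plus ?a ?b + quot_minus ?a ?b) * (?a - ?b)
        + \<theta> * (- (3/2 * ?b - 1/2 * ?c) * (?a - ?b))
        + \<tau> * ((ln (1 + ?a) - ln (1 + ?b) - ln (1 - ?a) + ln (1 - ?b)) * (?a - ?b))"
      by (simp add: d_def A_def field_simps)
    also have "\<dots> \<ge> ((G (1 + ?a) + G (1 - ?a)) - (G (1 + ?b) + G (1 - ?b)))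
        + \<theta> * (- (?a\<^sup>2 - ?b\<^sup>2) / 2 + (?a - ?b)\<^sup>2 / 4 - (?b - ?c)\<^sup>2 / 4)"
      using 1 2 unfolding quotient_mult_increment by linarith
    finally show "((G (1 + ?a) + G (1 - ?a)) - (G (1 + ?b) + G (1 - ?b)))
      - (\<theta> / 2) * (?a\<^sup>2 - ?b\<^sup>2) + (\<theta> / 4) * (d i j k)\<^sup>2 - (\<theta> / 4) * (e i j k)\<^sup>2
      \<le> d i j k * A i j k"
      by (simp add: d_def e_def field_simps)
  qed (use H in simp)
  also have "\<dots> = grid_inner L N d A" by (simp add: grid_inner_eq)
  finally have part_A: "?H * (period_sum N (\<lambda>i j k. G (1 + u i j k) + G (1 - u i j k))
            - period_sum N (\<lambda>i j k. G (1 + v i j k) + G (1 - v i j k)))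
      - \<theta> / 2 * (norm2_sq L N u - norm2_sq L N v)
      + \<theta> / 4 * norm2_sq L N d - \<theta> / 4 * norm2_sq L N e \<le> grid_inner L N d A" .
  have part_B: "\<epsilon>\<^sup>2 * ((grad_norm_sq L N u - grad_norm_sq L N v) / 2 + grad_norm_sq L N d / 8
      - grad_norm_sq L N e / 8) \<le> \<epsilon>\<^sup>2 * grid_inner L N d B"
    unfolding d_def e_def B_def by (intro mult_left_mono gradient_test assms) simp
  have part_C: "grid_inner L N d C
      = (norm_minus1_sq L N (demean L N u) - norm_minus1_sq L N (demean L N v)) / 2"
    unfolding d_def C_def by (rule nonlocal_test[OF assms(1,2) per(1,2)])
  have "grid_inner L N d (chem_pot L N \<theta> \<epsilon> \<sigma> \<tau> u v w)
      = grid_inner L N d A + \<epsilon>\<^sup>2 * grid_inner L N d B + \<sigma> * grid_inner L N d C"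
    unfolding chem grid_inner_lincomb_right by simp
  then have "grid_inner L N d (chem_pot L N \<theta> \<epsilon> \<sigma> \<tau> u v w)
      = grid_inner L N d A + \<epsilon>\<^sup>2 * grid_inner L N d B
        + \<sigma> * ((norm_minus1_sq L N (demean L N u) - norm_minus1_sq L N (demean L N v)) / 2)"
    unfolding part_C .
  with part_A part_B show ?thesis
    unfolding mod_energy_def energy_eq d_def[symmetric] e_def[symmetric]
    by (simp add: field_simps)
qed

lemma chem_pot_per:
  assumes "L > 0" "N > 0" "u \<in> V_per N" "v \<in> V_per N" "w \<in> V_per N"
  shows "chem_pot L N \<theta> \<epsilon> \<sigma> \<tau> u v w \<in> V_per N"
proof -
  let ?B = "laplace_h L N (\<lambda>i j k. 3/4 * u i j k + 1/4 * w i j k)"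
  let ?C = "inv_neg_laplace L N (demean L N (\<lambda>i j k. (u i j k + v i j k) / 2))"
  have "?B \<in> V_per N"
    using V_per_pointwise[OF assms(3,5), of "\<lambda>x y. 3/4 * x + 1/4 * y"] by (rule laplace_h_per)
  moreover have "?C \<in> V_per N"
    using inv_neg_laplace(1)[OF assms(1,2) demean_V0[OF assms(1,2)
        V_per_pointwise[OF assms(3,4), of "\<lambda>x y. (x + y) / 2"]]]
    by (simp add: V0_per_def)
  ultimately show ?thesis
    using assms(3-5) by (simp add: chem_pot_def V_per_def)
qed

lemma mobility_flux_dissipates:
  assumes "L > 0" "N > 0" "v \<in> V_per N" "w \<in> V_per N" "\<mu> \<in> V_per N"
  shows "grid_inner L N
     (div_h L N (face_mult (face_mobility M \<tau> v w) (grad_h L N \<mu>))) \<mu> \<le> 0"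
proof -
  define m where "m = (\<lambda>i j k. 3/2 * M (v i j k) - 1/2 * M (w i j k))"
  have m: "m \<in> V_per N" using assms(3,4) by (simp add: m_def V_per_def)
  define mx where "mx = (\<lambda>i j k. sqrt (((m (i + 1) j k + m i j k) / 2)\<^sup>2 + \<tau> ^ 6))"
  define my where "my = (\<lambda>i j k. sqrt (((m i (j + 1) k + m i j k) / 2)\<^sup>2 + \<tau> ^ 6))"
  define mz where "mz = (\<lambda>i j k. sqrt (((m i j (k + 1) + m i j k) / 2)\<^sup>2 + \<tau> ^ 6))"
  have mob: "face_mobility M \<tau> v w = (mx, my, mz)"
    by (simp add: face_mobility_def face_map_def A_face_def m_def mx_def my_def mz_def)
  have pos: "mx i j k \<ge> 0" "my i j k \<ge> 0" "mz i j k \<ge> 0" for i j k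
    by (simp_all add: mx_def my_def mz_def)
  have "mx \<in> V_per N" "my \<in> V_per N" "mz \<in> V_per N"
    using V_per_pointwise[OF V_per_shift[OF m, of 1 0 0] m, of "\<lambda>x y. sqrt (((x + y) / 2)\<^sup>2 + \<tau> ^ 6)"]
      V_per_pointwise[OF V_per_shift[OF m, of 0 1 0] m, of "\<lambda>x y. sqrt (((x + y) / 2)\<^sup>2 + \<tau> ^ 6)"]
      V_per_pointwise[OF V_per_shift[OF m, of 0 0 1] m, of "\<lambda>x y. sqrt (((x + y) / 2)\<^sup>2 + \<tau> ^ 6)"]
    by (simp_all add: mx_def my_def mz_def)
  moreover obtain gx gy gz where g: "grad_h L N \<mu> = (gx, gy, gz)" by (rule prod_cases3)
  moreover have "gx \<in> V_per N" "gy \<in> V_per N" "gz \<in> V_per N"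
    using grad_h_per[OF assms(5), of L] by (auto simp: g face_per_def)
  ultimately have flux: "face_mult (mx, my, mz) (gx, gy, gz) \<in> face_per N"
    by (auto simp: face_mult_def face_per_def intro: V_per_pointwise)
  have "face_inner L N (face_mult (mx, my, mz) (gx, gy, gz)) (gx, gy, gz) \<ge> 0"
    using mesh_pos[OF assms(1,2)] pos
    by (auto simp: face_inner_def face_mult_def mult.assoc power2_eq_square[symmetric]
        intro!: mult_nonneg_nonneg period_sum_nonneg add_nonneg_nonneg)
  with div_grad_adjoint[OF flux assms(5), of L] show ?thesis
    by (simp add: mob g)
qed

lemma scheme_step_dissipates:
  assumes "L > 0" "N > 0" "\<theta> > 0" "\<tau> > 0"
    and sol: "scheme_solution L N \<theta> \<epsilon> \<sigma> M \<tau> \<phi>" and n: "n \<ge> 0"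
  shows "mod_energy L N \<theta> \<epsilon> \<sigma> (\<phi> (n + 1)) (\<phi> n) \<le> mod_energy L N \<theta> \<epsilon> \<sigma> (\<phi> n) (\<phi> (n - 1))"
proof -
  let ?u = "\<phi> (n + 1)" and ?v = "\<phi> n" and ?w = "\<phi> (n - 1)"
  let ?mu = "chem_pot L N \<theta> \<epsilon> \<sigma> \<tau> ?u ?v ?w"
  have adm: "\<phi> m \<in> V_per N \<and> norm_sup N (\<phi> m) < 1" if "m \<ge> -1" for m
    using sol that by (simp add: scheme_solution_def)
  have per: "?u \<in> V_per N" "?v \<in> V_per N" "?w \<in> V_per N" using adm n by simp_all
  have bd: "\<bar>?u i j k\<bar> < 1" "\<bar>?v i j k\<bar> < 1" for i j k
    using adm[of n] adm[of "n + 1"] n norm_sup_less_imp[OF assms(2)] by simp_all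
  have "?u i j k - ?v i j k = \<tau> * div_h L N (face_mult (face_mobility M \<tau> ?v ?w)
      (grad_h L N ?mu)) i j k" for i j k
  proof -
    have "(?u i j k - ?v i j k) / \<tau> = div_h L N (face_mult (face_mobility M \<tau> ?v ?w)
      (grad_h L N ?mu)) i j k"
      using sol n by (simp add: scheme_solution_def)
    then show ?thesis using assms(4) by (simp add: field_simps)
  qed
  then have "grid_inner L N (\<lambda>i j k. ?u i j k - ?v i j k) ?mu
     = \<tau> * grid_inner L N (div_h L N (face_mult (face_mobility M \<tau> ?v ?w) (grad_h L N ?mu))) ?mu"
    by (simp add: grid_inner_eq mult.assoc period_sum_cmult)
  also have "\<dots> \<le> 0"
    using assms(4) mobility_flux_dissipates[OF assms(1,2) per(2,3) chem_pot_per[OF assms(1,2) per]]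
    by (simp add: mult_le_0_iff)
  finally show ?thesis
    using mod_energy_increment_le[OF assms(1-4) per bd, of \<epsilon> \<sigma>] by simp
qed

section \<open>Fourier projection of the initial datum\<close>

definition cell :: "real \<Rightarrow> (real ^ 3) set" where
  "cell L = cbox 0 (\<chi> i. L)"

text \<open>
  The shifted cell overhangs the original one by a slab of width \<open>s\<close>, which by periodicity carries
  the same integral as the slab that the shift uncovers.
\<close>

lemma periodic_integral_shift:
  fixes f :: "real ^ 3 \<Rightarrow> complex"
  assumes cont: "continuous_on UNIV f" and per: "\<And>x. f (x + axis i L) = f x"
    and s: "0 \<le> s" "s \<le> L"
  shows "integral (cell L) (\<lambda>x. f (x + axis i s)) = integral (cell L) f"
proof -
  define slab :: "real \<Rightarrow> real \<Rightarrow> (real ^ 3) set" where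
    "slab a b = cbox (\<chi> j. if j = i then a else 0) (\<chi> j. if j = i then b else L)" for a b
  have split: "integral (slab a b) f = integral (slab a c) f + integral (slab c b) f"
    if "a \<le> c" "c \<le> b" for a b c
  proof -
    have "slab a b \<inter> {x. x \<bullet> axis i 1 \<le> c} = slab a c" "slab a b \<inter> {x. x \<bullet> axis i 1 \<ge> c} = slab c b"
      using that by (auto simp: slab_def mem_box_cart inner_axis split: if_splits)
        (smt (verit))+
    moreover have "f integrable_on slab a b"
      unfolding slab_def using cont by (intro integrable_continuous) (rule continuous_on_subset, auto)
    ultimately show ?thesis
      using integral_split[of f "\<chi> j. if j = i then a else 0" "\<chi> j. if j = i then b else L" "axis i 1" c]
      by (simp add: slab_def)
  qed
  have shift: "integral (slab a b) (\<lambda>x. f (x + axis i c)) = integral (slab (a + c) (b + c)) f" for a b c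
  proof -
    have "(\<chi> j. if j = i then a else 0) + axis i c = (\<chi> j. if j = i then a + c else 0)"
      "(\<chi> j. if j = i then b else L) + axis i c = (\<chi> j. if j = i then b + c else L)"
      by (auto simp: vec_eq_iff axis_def)
    then show ?thesis
      using integral_shift_cbox_plus[of "\<chi> j. if j = i then a else 0" "\<chi> j. if j = i then b else L" f "axis i c"]
      by (simp add: slab_def o_def add.commute)
  qed
  have cell: "cell L = slab 0 L"
    by (simp add: cell_def slab_def zero_vec_def cong: if_cong)
  have "integral (slab 0 s) f = integral (slab L (L + s)) f"
    using shift[of 0 s L] by (simp add: per add.commute)
  moreover have "integral (slab 0 L) f = integral (slab 0 s) f + integral (slab s L) f"
    by (rule split[OF s])
  moreover have "integral (slab s (s + L)) f = integral (slab s L) f + integral (slab L (L + s)) f"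
    using split[of s L "s + L"] s by (simp add: add.commute)
  ultimately show ?thesis
    using shift[of 0 L s] by (simp add: cell add.commute)
qed

definition mode :: "real \<Rightarrow> int \<times> int \<times> int \<Rightarrow> real ^ 3 \<Rightarrow> complex" where
  "mode L = (\<lambda>(a, b, c). fourier_mode L a b c)"

definition wave_number :: "int \<times> int \<times> int \<Rightarrow> 3 \<Rightarrow> int" where
  "wave_number = (\<lambda>(a, b, c) i. if i = 1 then a else if i = 2 then b else c)"

lemma mode_shift:
  "mode L k (x + axis i s) = exp (\<i> * of_real (2 * pi / L * of_int (wave_number k i) * s)) * mode L k x"
proof -
  obtain a b c where k: "k = (a, b, c)" by (rule prod_cases3)
  have "i = 1 \<or> i = 2 \<or> i = 3" by (rule exhaust_3)
  then show ?thesis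
    by (auto simp: k mode_def wave_number_def fourier_mode_def axis_def exp_add[symmetric] algebra_simps)
qed

lemma exp_two_pi_int: "exp (\<i> * of_real (2 * pi * of_int n)) = 1"
  by (simp add: exp_eq_1)

lemma mode_periodic: "L > 0 \<Longrightarrow> mode L k (x + axis i L) = mode L k x"
  using exp_two_pi_int[of "wave_number k i"] by (simp add: mode_shift)

lemma continuous_mode: "continuous_on A (mode L k)"
proof -
  obtain a b c where k: "k = (a, b, c)" by (rule prod_cases3)
  show ?thesis unfolding k mode_def fourier_mode_def prod.case
    by (intro continuous_intros)
qed

lemma mode_mult_cnj:
  "mode L (a, b, c) x * cnj (mode L (a', b', c') x) = mode L (a - a', b - b', c - c') x"
  by (simp add: mode_def fourier_mode_def exp_cnj exp_add[symmetric] algebra_simps)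

lemma mode_zero: "mode L (0, 0, 0) x = 1"
  by (simp add: mode_def fourier_mode_def)

lemma content_cell: "L > 0 \<Longrightarrow> measure lborel (cell L) = L ^ 3"
  unfolding cell_def by (subst content_cbox_cart) (auto simp: interval_eq_empty_cart)

text \<open>
  For a nonconstant mode, a shift by half a wavelength in a direction of nonzero wave number changes
  its sign but not its integral.
\<close>

lemma integral_mode:
  assumes "L > 0"
  shows "integral (cell L) (mode L k) = (if k = (0, 0, 0) then of_real (L ^ 3) else 0)"
proof (cases "k = (0, 0, 0)")
  case True
  have "mode L k = (\<lambda>x. 1)" using True by (auto simp: mode_zero)
  then show ?thesis
    using True content_cell[OF assms] by (simp add: cell_def scaleR_conv_of_real)
next
  case False
  obtain a b c where k: "k = (a, b, c)" by (rule prod_cases3)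
  have "wave_number k 1 = a" "wave_number k 2 = b" "wave_number k 3 = c"
    by (simp_all add: k wave_number_def)
  with False obtain i where i: "wave_number k i \<noteq> 0"
    unfolding k by (metis prod.inject)
  define n where "n = \<bar>wave_number k i\<bar>"
  (* Half a wavelength in direction i; it is at most L, as the shift lemma requires. *)
  define s where "s = L / (2 * of_int n)"
  have n: "n \<ge> 1" using i by (simp add: n_def)
  then have "L * 1 \<le> L * (2 * of_int n)" using assms by (intro mult_left_mono) auto
  then have s: "0 \<le> s" "s \<le> L" using assms n by (auto simp: s_def field_simps)
  have half: "exp (\<i> * of_real (2 * pi / L * of_int (wave_number k i) * s)) = - 1"
  proof (cases "wave_number k i > 0")
    case True
    then have "2 * pi / L * of_int (wave_number k i) * s = pi"
      using assms by (simp add: s_def n_def)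
    then show ?thesis by (simp only:) simp
  next
    case False
    then have "2 * pi / L * of_int (wave_number k i) * s = - pi"
      using assms i by (simp add: s_def n_def)
    then show ?thesis by (simp only:) (simp add: exp_minus)
  qed
  have "integral (cell L) (mode L k) = integral (cell L) (\<lambda>x. mode L k (x + axis i s))"
    using periodic_integral_shift[OF continuous_mode mode_periodic[OF assms] s] by simp
  also have "\<dots> = integral (cell L) (\<lambda>x. - mode L k x)"
    by (simp only: mode_shift half) simp
  also have "\<dots> = - integral (cell L) (mode L k)"
    by (rule Henstock_Kurzweil_Integration.integral_neg)
  finally have "2 * integral (cell L) (mode L k) = 0" by simp
  then show ?thesis using False by simp
qed

definition modes_upto :: "nat \<Rightarrow> (int \<times> int \<times> int) set" where
  "modes_upto K = {- int K..int K} \<times> {- int K..int K} \<times> {- int K..int K}"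

lemma finite_modes_upto: "finite (modes_upto K)"
  by (simp add: modes_upto_def)

definition mode_coeff :: "real \<Rightarrow> (real ^ 3 \<Rightarrow> real) \<Rightarrow> int \<times> int \<times> int \<Rightarrow> complex" where
  "mode_coeff L f = (\<lambda>(a, b, c). fourier_coeff L f a b c)"

lemma fourier_proj_eq: "fourier_proj L K f x = (\<Sum>k\<in>modes_upto K. mode_coeff L f k * mode L k x)"
  by (simp add: fourier_proj_def modes_upto_def mode_coeff_def mode_def sum.cartesian_product split_beta)

lemma mode_coeff_eq:
  "mode_coeff L f k = integral (cell L) (\<lambda>x. of_real (f x) * cnj (mode L k x)) / of_real (L ^ 3)"
proof -
  obtain a b c where k: "k = (a, b, c)" by (rule prod_cases3)
  show ?thesis
    unfolding k mode_coeff_def fourier_coeff_def mode_def cell_def prod.case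
    by (simp add: integral_open_interval)
qed

lemma integrable_on_cell: "continuous_on UNIV f \<Longrightarrow> f integrable_on cell L"
  for f :: "real ^ 3 \<Rightarrow> 'a::banach"
  unfolding cell_def by (rule integrable_continuous) (rule continuous_on_subset, auto)

lemma integral_mode_mult_cnj:
  assumes "L > 0"
  shows "integral (cell L) (\<lambda>x. mode L k x * cnj (mode L l x)) = (if k = l then of_real (L ^ 3) else 0)"
proof -
  obtain a b c where k: "k = (a, b, c)" by (rule prod_cases3)
  obtain a' b' c' where l: "l = (a', b', c')" by (rule prod_cases3)
  show ?thesis unfolding k l mode_mult_cnj integral_mode[OF assms] by auto
qed

text \<open>
  With \<open>P\<close> the projection of \<open>g\<close>, expand \<open>0 \<le> \<integral> |g - P|\<^sup>2\<close>; by orthogonality both \<open>\<integral> g P\<^sup>*\<close> and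
  \<open>\<integral> |P|\<^sup>2\<close> equal \<open>L\<^sup>3\<close> times the sum of the squared coefficients.
\<close>

lemma bessel_inequality:
  assumes L: "L > 0" and cont: "continuous_on UNIV g" and bd: "\<And>x. x \<in> cell L \<Longrightarrow> \<bar>g x\<bar> \<le> B"
  shows "(\<Sum>k\<in>modes_upto K. (cmod (mode_coeff L g k))\<^sup>2) \<le> B\<^sup>2"
proof -
  let ?S = "modes_upto K" and ?c = "mode_coeff L g"
  define P where "P x = fourier_proj L K g x" for x
  define E where "E = (\<Sum>k\<in>?S. (cmod (?c k))\<^sup>2)"
  have P: "P x = (\<Sum>k\<in>?S. ?c k * mode L k x)" for x
    unfolding P_def by (rule fourier_proj_eq)
  have contP: "continuous_on UNIV P"
    unfolding P[abs_def] by (intro continuous_on_sum continuous_on_mult continuous_on_const continuous_mode)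
  note ci = continuous_intros continuous_mode cont contP
  have cg: "integral (cell L) (\<lambda>x. of_real (g x) * cnj (mode L k x)) = of_real (L ^ 3) * ?c k" for k
    using L by (simp add: mode_coeff_eq)
  have gP: "integral (cell L) (\<lambda>x. of_real (g x) * cnj (P x)) = of_real (L ^ 3 * E)"
  proof -
    have "integral (cell L) (\<lambda>x. of_real (g x) * cnj (P x))
       = integral (cell L) (\<lambda>x. \<Sum>k\<in>?S. cnj (?c k) * (of_real (g x) * cnj (mode L k x)))"
      by (simp add: P sum_distrib_left algebra_simps)
    also have "\<dots> = (\<Sum>k\<in>?S. integral (cell L) (\<lambda>x. cnj (?c k) * (of_real (g x) * cnj (mode L k x))))"
      by (intro Henstock_Kurzweil_Integration.integral_sum finite_modes_upto integrable_on_cell ci)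
    also have "\<dots> = (\<Sum>k\<in>?S. of_real (L ^ 3) * (?c k * cnj (?c k)))"
      by (intro sum.cong refl) (simp only: Henstock_Kurzweil_Integration.integral_mult_right cg, simp only: mult_ac)
    also have "\<dots> = of_real (L ^ 3 * E)"
      by (simp add: E_def complex_norm_square[symmetric] sum_distrib_left)
    finally show ?thesis .
  qed
  have PP: "integral (cell L) (\<lambda>x. P x * cnj (P x)) = of_real (L ^ 3 * E)"
  proof -
    have "integral (cell L) (\<lambda>x. P x * cnj (P x))
       = integral (cell L) (\<lambda>x. \<Sum>k\<in>?S. \<Sum>l\<in>?S. (?c k * cnj (?c l)) * (mode L k x * cnj (mode L l x)))"
      by (simp add: P sum_product algebra_simps)
    also have "\<dots> = (\<Sum>k\<in>?S. integral (cell L)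
        (\<lambda>x. \<Sum>l\<in>?S. (?c k * cnj (?c l)) * (mode L k x * cnj (mode L l x))))"
      by (intro Henstock_Kurzweil_Integration.integral_sum finite_modes_upto integrable_on_cell ci)
    also have "\<dots> = (\<Sum>k\<in>?S. \<Sum>l\<in>?S. integral (cell L)
        (\<lambda>x. (?c k * cnj (?c l)) * (mode L k x * cnj (mode L l x))))"
      by (intro sum.cong refl Henstock_Kurzweil_Integration.integral_sum finite_modes_upto
          integrable_on_cell ci)
    also have "\<dots> = (\<Sum>k\<in>?S. \<Sum>l\<in>?S. if l = k then ?c k * cnj (?c k) * of_real (L ^ 3) else 0)"
      by (intro sum.cong refl) (simp add: integral_mode_mult_cnj[OF L])
    also have "\<dots> = of_real (L ^ 3 * E)"
      by (simp add: finite_modes_upto E_def complex_norm_square[symmetric] sum_distrib_left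
          sum_distrib_right[symmetric] mult.commute)
    finally show ?thesis .
  qed
  have Re_int: "integral (cell L) (\<lambda>x. Re (f x)) = Re (integral (cell L) f)"
    if "continuous_on UNIV f" for f :: "real ^ 3 \<Rightarrow> complex"
    using integral_linear[OF integrable_on_cell[OF that] bounded_linear_Re] by (simp add: o_def)
  have expand: "(cmod (of_real (g x) - P x))\<^sup>2
      = (g x)\<^sup>2 - 2 * Re (of_real (g x) * cnj (P x)) + Re (P x * cnj (P x))" for x
    unfolding cmod_power2 by (simp add: power2_eq_square algebra_simps)
  have "0 \<le> integral (cell L) (\<lambda>x. (cmod (of_real (g x) - P x))\<^sup>2)"
    by (intro integral_nonneg integrable_on_cell ci) auto
  also have "\<dots> = integral (cell L) (\<lambda>x. (g x)\<^sup>2 - 2 * Re (of_real (g x) * cnj (P x)))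
      + integral (cell L) (\<lambda>x. Re (P x * cnj (P x)))"
    unfolding expand by (intro Henstock_Kurzweil_Integration.integral_add integrable_on_cell ci)
  also have "integral (cell L) (\<lambda>x. (g x)\<^sup>2 - 2 * Re (of_real (g x) * cnj (P x)))
     = integral (cell L) (\<lambda>x. (g x)\<^sup>2) - integral (cell L) (\<lambda>x. 2 * Re (of_real (g x) * cnj (P x)))"
    by (intro Henstock_Kurzweil_Integration.integral_diff integrable_on_cell ci)
  also have "integral (cell L) (\<lambda>x. 2 * Re (of_real (g x) * cnj (P x))) = 2 * (L ^ 3 * E)"
    by (simp only: Henstock_Kurzweil_Integration.integral_mult_right)
      (subst Re_int, intro ci, simp only: gP Re_complex_of_real)
  also have "integral (cell L) (\<lambda>x. Re (P x * cnj (P x))) = L ^ 3 * E"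
    by (subst Re_int) (intro ci, simp add: PP)
  finally have "L ^ 3 * E \<le> integral (cell L) (\<lambda>x. (g x)\<^sup>2)" by (simp add: mult.commute)
  also have "\<dots> \<le> integral (cell L) (\<lambda>x. B\<^sup>2)"
  proof (intro integral_le integrable_on_cell ci)
    fix x assume "x \<in> cell L"
    from bd[OF this] show "(g x)\<^sup>2 \<le> B\<^sup>2" by (meson abs_le_square_iff abs_ge_self order_trans)
  qed
  also have "\<dots> = L ^ 3 * B\<^sup>2"
    using content_cell[OF L] by (simp add: cell_def)
  finally show ?thesis using L by (simp add: E_def)
qed

lemma mode_at_cell_center:
  "mode L (a, b, c) (cell_center L N i j k) =
     exp (\<i> * of_real (2 * pi / L * of_int a * ((of_int i - 1/2) * mesh L N)))
   * exp (\<i> * of_real (2 * pi / L * of_int b * ((of_int j - 1/2) * mesh L N)))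
   * exp (\<i> * of_real (2 * pi / L * of_int c * ((of_int k - 1/2) * mesh L N)))"
  by (simp add: mode_def fourier_mode_def cell_center_def exp_add[symmetric] ring_distribs mult.assoc)

text \<open>
  Moving on by one node multiplies each term by the root of unity \<open>exp (2 \<pi> \<i> a / N)\<close> and, by
  periodicity, leaves the sum unchanged. The root differs from \<open>1\<close> unless \<open>N\<close> divides \<open>a\<close>.
\<close>

lemma node_sum_exp:
  assumes "L > 0" "\<bar>a\<bar> < int N"
  shows "(\<Sum>i = 1..int N. exp (\<i> * of_real (2 * pi / L * of_int a * ((of_int i - 1/2) * mesh L N))))
     = (if a = 0 then of_nat N else 0)"
proof (cases "a = 0")
  case False
  define w where "w = exp (\<i> * of_real (2 * pi * of_int a / real N))"
  define F where "F i = exp (\<i> * of_real (2 * pi / L * of_int a * ((of_int i - 1/2) * mesh L N)))" for i :: int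
  have N: "N > 0" using assms by auto
  have "2 * pi / L * of_int a * ((of_int (i + 1) - 1/2) * mesh L N)
     = 2 * pi * of_int a / real N + 2 * pi / L * of_int a * ((of_int i - 1/2) * mesh L N)" for i :: int
    using assms N by (simp add: mesh_def field_simps)
  then have step: "F (i + 1) = w * F i" for i
    unfolding F_def w_def by (simp only: exp_add[symmetric] of_real_add distrib_left)
  have "2 * pi / L * of_int a * ((of_int (i + int N) - 1/2) * mesh L N)
     = 2 * pi * of_int a + 2 * pi / L * of_int a * ((of_int i - 1/2) * mesh L N)" for i :: int
    using assms N by (simp add: mesh_def field_simps)
  then have "F (i + int N) = exp (\<i> * of_real (2 * pi * of_int a)) * F i" for i
    unfolding F_def by (simp only: exp_add[symmetric] of_real_add distrib_left)
  then have "F (i + int N) = F i" for i by (simp only: exp_two_pi_int) simp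
  from sum_period_shift[of F, OF this]
  have "w * (\<Sum>i = 1..int N. F i) = (\<Sum>i = 1..int N. F i)"
    by (simp add: step sum_distrib_left[symmetric])
  moreover have "w \<noteq> 1"
  proof
    assume "w = 1"
    then obtain n :: int where "2 * pi * of_int a / real N = of_int (2 * n) * pi"
      by (auto simp: w_def exp_eq_1)
    then have "real_of_int a = of_int (n * int N)" using N by (simp add: field_simps)
    then have "a = n * int N" by (simp only: of_int_eq_iff)
    with assms(2) have "\<bar>n\<bar> * int N < 1 * int N" by (simp add: abs_mult)
    then have "\<bar>n\<bar> < 1" using N by (subst (asm) mult_less_cancel_right) auto
    with \<open>a = n * int N\<close> False show False by simp
  qed
  ultimately show ?thesis using False by (simp add: F_def)
qed simp

lemma node_sum_mode:
  assumes "L > 0" "\<bar>a\<bar> < int N" "\<bar>b\<bar> < int N" "\<bar>c\<bar> < int N"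
  shows "(\<Sum>i = 1..int N. \<Sum>j = 1..int N. \<Sum>k = 1..int N. mode L (a, b, c) (cell_center L N i j k))
     = (if (a, b, c) = (0, 0, 0) then of_nat N ^ 3 else 0)"
  unfolding mode_at_cell_center
  unfolding sum_distrib_left[symmetric] sum_distrib_right[symmetric] node_sum_exp[OF assms(1,2)]
    node_sum_exp[OF assms(1,3)] node_sum_exp[OF assms(1,4)]
  by (auto simp: power3_eq_cube)

text \<open>
  Wave numbers of two modes of degree at most \<open>K\<close> differ by at most \<open>2 K < N\<close> in each direction, so no
  two of them alias on the grid and the modes stay orthogonal over the nodes.
\<close>

lemma node_sum_fourier_proj:
  assumes L: "L > 0" and N: "N = 2 * K + 1"
  shows "(\<Sum>i = 1..int N. \<Sum>j = 1..int N. \<Sum>k = 1..int N.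
       (cmod (fourier_proj L K g (cell_center L N i j k)))\<^sup>2)
     = real N ^ 3 * (\<Sum>k\<in>modes_upto K. (cmod (mode_coeff L g k))\<^sup>2)"
proof -
  let ?S = "modes_upto K" and ?c = "mode_coeff L g"
  define Q where "Q = {1..int N} \<times> {1..int N} \<times> {1..int N}"
  define X where "X = (\<lambda>(i, j, k). cell_center L N i j k)"
  have orth: "(\<Sum>q\<in>Q. mode L k (X q) * cnj (mode L l (X q))) = (if l = k then of_nat N ^ 3 else 0)"
    if "k \<in> ?S" "l \<in> ?S" for k l
  proof -
    obtain a b c where k: "k = (a, b, c)" by (rule prod_cases3)
  obtain a' b' c' where l: "l = (a', b', c')" by (rule prod_cases3)
    have "\<bar>a - a'\<bar> < int N" "\<bar>b - b'\<bar> < int N" "\<bar>c - c'\<bar> < int N"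
      using that by (auto simp: k l modes_upto_def N)
    from node_sum_mode[OF L this] show ?thesis
      unfolding k l mode_mult_cnj by (auto simp: Q_def X_def sum.cartesian_product split_beta)
  qed
  have "complex_of_real (\<Sum>q\<in>Q. (cmod (fourier_proj L K g (X q)))\<^sup>2)
     = (\<Sum>q\<in>Q. \<Sum>k\<in>?S. \<Sum>l\<in>?S. (?c k * cnj (?c l)) * (mode L k (X q) * cnj (mode L l (X q))))"
    by (simp only: of_real_sum fourier_proj_eq complex_norm_square cnj_sum sum_product
        complex_cnj_mult mult_ac)
  also have "\<dots> = (\<Sum>k\<in>?S. \<Sum>l\<in>?S. \<Sum>q\<in>Q. (?c k * cnj (?c l)) * (mode L k (X q) * cnj (mode L l (X q))))"
    by (subst sum.swap, rule sum.cong[OF refl], rule sum.swap)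
  also have "\<dots> = (\<Sum>k\<in>?S. \<Sum>l\<in>?S. if l = k then ?c k * cnj (?c k) * of_nat N ^ 3 else 0)"
    by (intro sum.cong refl) (simp add: sum_distrib_left[symmetric] orth)
  also have "\<dots> = complex_of_real (real N ^ 3 * (\<Sum>k\<in>?S. (cmod (?c k))\<^sup>2))"
    by (simp add: finite_modes_upto complex_norm_square[symmetric] sum_distrib_left
        sum_distrib_right[symmetric] mult.commute)
  finally have "(\<Sum>q\<in>Q. (cmod (fourier_proj L K g (X q)))\<^sup>2)
      = real N ^ 3 * (\<Sum>k\<in>?S. (cmod (?c k))\<^sup>2)"
    by (simp only: of_real_eq_iff)
  then show ?thesis
    by (simp add: Q_def X_def sum.cartesian_product split_beta)
qed

text \<open>
  Translation multiplies the Fourier coefficient of index \<open>k\<close> by a phase, and it multiplies the mode \<open>k\<close>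
  by the same phase.
\<close>

lemma fourier_proj_difference_quotient:
  assumes L: "L > 0" and cont: "continuous_on UNIV f" and per: "L_periodic L f"
    and s: "0 < s" "s \<le> L"
  shows "fourier_proj L K (\<lambda>x. (f (x + axis i s) - f x) / s) x
    = (fourier_proj L K f (x + axis i s) - fourier_proj L K f x) / of_real s"
proof -
  define ph where "ph k = exp (\<i> * of_real (2 * pi / L * of_int (wave_number k i) * s))" for k
  have ph: "ph k * cnj (ph k) = 1" for k
    by (simp add: ph_def exp_cnj exp_add[symmetric])
  define F where "F k x = of_real (f x) * cnj (mode L k x)" for k x
  have contF: "continuous_on UNIV (F k)" for k
    unfolding F_def by (intro continuous_intros cont continuous_mode)
  have perF: "F k (x + axis i L) = F k x" for k x
    using per by (simp add: F_def mode_periodic[OF L] L_periodic_def)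
  have shiftF: "of_real (f (x + axis i s)) * cnj (mode L k x) = ph k * F k (x + axis i s)" for k x
  proof -
    have "mode L k (x + axis i s) = ph k * mode L k x" unfolding ph_def by (rule mode_shift)
    then have "ph k * F k (x + axis i s)
        = (ph k * cnj (ph k)) * (of_real (f (x + axis i s)) * cnj (mode L k x))"
      by (simp only: F_def complex_cnj_mult mult_ac)
    then show ?thesis by (simp only: ph) simp
  qed
  have co: "mode_coeff L (\<lambda>x. (f (x + axis i s) - f x) / s) k = (ph k - 1) / of_real s * mode_coeff L f k" for k
  proof -
    have "integral (cell L) (\<lambda>x. of_real ((f (x + axis i s) - f x) / s) * cnj (mode L k x))
       = integral (cell L) (\<lambda>x. (1 / of_real s) * (ph k * F k (x + axis i s) - F k x))"
      unfolding shiftF[symmetric] by (simp add: F_def algebra_simps diff_divide_distrib)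
    also have "\<dots> = (1 / of_real s) * (integral (cell L) (\<lambda>x. ph k * F k (x + axis i s)) - integral (cell L) (F k))"
    proof -
      have "continuous_on UNIV (\<lambda>x. F k (x + axis i s))"
        by (rule continuous_on_compose2[OF contF]) (auto intro!: continuous_intros)
      then have "(\<lambda>x. ph k * F k (x + axis i s)) integrable_on cell L"
        by (intro integrable_on_cell continuous_intros)
      then show ?thesis
        by (subst Henstock_Kurzweil_Integration.integral_mult_right,
            subst Henstock_Kurzweil_Integration.integral_diff) (auto intro: integrable_on_cell contF)
    qed
    also have "\<dots> = (1 / of_real s) * (ph k * integral (cell L) (F k) - integral (cell L) (F k))"
      using periodic_integral_shift[OF contF perF, of s k] s by simp
    finally have int: "integral (cell L) (\<lambda>x. of_real ((f (x + axis i s) - f x) / s) * cnj (mode L k x))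
       = (ph k - 1) / of_real s * integral (cell L) (F k)"
      by (simp only: left_diff_distrib) (simp add: diff_divide_distrib left_diff_distrib)
    have "F k = (\<lambda>x. of_real (f x) * cnj (mode L k x))" by (simp add: fun_eq_iff F_def)
    then show ?thesis
      unfolding mode_coeff_eq int by simp
  qed
  show ?thesis
    unfolding fourier_proj_eq co mode_shift ph_def[symmetric]
    by (simp add: sum_subtractf[symmetric] sum_divide_distrib algebra_simps diff_divide_distrib)
qed

lemma C_diff_imp_continuous: "C_diff n f \<Longrightarrow> continuous_on UNIV f"
  by (cases n) (auto intro!: continuous_at_imp_continuous_on differentiable_imp_continuous_within)

text \<open>
  The mean value theorem on segments starting in the cell. A step of length at most \<open>L\<close> stays in the
  doubled cell, where the continuous partial derivatives are bounded by compactness.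
\<close>

lemma C_diff_Suc_directional_lipschitz:
  assumes "C_diff (Suc n) f"
  shows "\<exists>B. \<forall>x\<in>cell L. \<forall>s. 0 < s \<longrightarrow> s \<le> L \<longrightarrow> (\<forall>i. \<bar>f (x + axis i s) - f x\<bar> \<le> B * s)"
proof -
  define D where "D i x = frechet_derivative f (at x) (axis i 1)" for i x
  have diff: "f differentiable (at x)" for x using assms by simp
  have contD: "continuous_on UNIV (D i)" for i
    unfolding D_def using assms by (auto intro: C_diff_imp_continuous)
  have "\<exists>b. \<forall>x\<in>cell (2 * L). \<bar>D i x\<bar> \<le> b" for i
  proof -
    have "compact (D i ` cell (2 * L))"
      unfolding cell_def by (intro compact_continuous_image compact_cbox continuous_on_subset[OF contD]) auto
    then have "bounded (D i ` cell (2 * L))"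
      by (rule compact_imp_bounded)
    then show ?thesis
      by (auto simp: bounded_iff)
  qed
  then obtain b where b: "\<And>i x. x \<in> cell (2 * L) \<Longrightarrow> \<bar>D i x\<bar> \<le> b i" by metis
  define B where "B = (\<Sum>i\<in>UNIV. \<bar>b i\<bar>)"
  have bB: "b i \<le> B" for i
  proof -
    have "b i \<le> \<bar>b i\<bar>" by simp
    also have "\<dots> \<le> B" unfolding B_def by (rule member_le_sum) auto
    finally show ?thesis .
  qed
  have "\<bar>f (x + axis i s) - f x\<bar> \<le> B * s" if x: "x \<in> cell L" and s: "0 < s" "s \<le> L" for x s i
  proof -
    have ax: "t *\<^sub>R axis i (1::real) = axis i t" for t by (simp add: vec_eq_iff axis_def)
    have der: "((\<lambda>t. f (x + axis i t)) has_derivative (\<lambda>h. h * D i (x + axis i t))) (at t within S)" for t S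
    proof -
      have f': "(f has_derivative frechet_derivative f (at y)) (at y)" for y
        using diff by (simp add: frechet_derivative_works)
      have "((\<lambda>t. f (x + t *\<^sub>R axis i 1)) has_derivative
          (\<lambda>h. frechet_derivative f (at (x + t *\<^sub>R axis i 1)) (h *\<^sub>R axis i 1))) (at t within S)"
        by (rule has_derivative_compose[OF _ f']) (auto intro!: derivative_eq_intros)
      moreover have "frechet_derivative f (at (x + t *\<^sub>R axis i 1)) (h *\<^sub>R axis i 1)
          = h * D i (x + axis i t)" for h
        using linear_cmul[OF linear_frechet_derivative[OF diff], of "x + axis i t" h "axis i 1"]
        by (simp only: D_def ax real_scaleR_def)
      ultimately show ?thesis by (simp add: ax)
    qed
    obtain t where t: "t \<in> {0<..<s}" "f (x + axis i s) - f (x + axis i 0) = (s - 0) * D i (x + axis i t)"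
      using mvt_simple[OF s(1) der] by blast
    have "x + axis i t \<in> cell (2 * L)"
    proof -
      have "0 \<le> (x + axis i t) $ j \<and> (x + axis i t) $ j \<le> 2 * L" for j
      proof -
        have "0 \<le> x $ j" "x $ j \<le> L" using x by (auto simp: cell_def mem_box_cart)
        moreover have "0 \<le> axis i t $ j" "axis i t $ j \<le> L"
          using t s by (auto simp: axis_def)
        ultimately show ?thesis by simp
      qed
      then show ?thesis by (simp add: cell_def mem_box_cart)
    qed
    then have "\<bar>D i (x + axis i t)\<bar> \<le> B" using b bB order_trans by blast
    then have "s * \<bar>D i (x + axis i t)\<bar> \<le> s * B" using s by (intro mult_left_mono) auto
    moreover have "x + axis i 0 = x" by (simp add: vec_eq_iff axis_def)
    ultimately show ?thesis using t(2) s by (simp only:) (simp add: abs_mult mult.commute)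
  qed
  then show ?thesis by blast
qed

lemma cell_center_shift:
  "cell_center L N (i + 1) j k = cell_center L N i j k + axis 1 (mesh L N)"
  "cell_center L N i (j + 1) k = cell_center L N i j k + axis 2 (mesh L N)"
  "cell_center L N i j (k + 1) = cell_center L N i j k + axis 3 (mesh L N)"
  by (simp_all add: cell_center_def vec_eq_iff forall_3 axis_def algebra_simps)

lemma node_sum_projected_difference_le:
  assumes L: "L > 0" and N: "N = 2 * K + 1" and cont: "continuous_on UNIV f"
    and per: "L_periodic L f"
    and lip: "\<And>x s i. x \<in> cell L \<Longrightarrow> 0 < s \<Longrightarrow> s \<le> L \<Longrightarrow> \<bar>f (x + axis i s) - f x\<bar> \<le> B * s"
  shows "period_sum N (\<lambda>i j k. (cmod ((fourier_proj L K f (cell_center L N i j k + axis m (mesh L N))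
      - fourier_proj L K f (cell_center L N i j k)) / of_real (mesh L N)))\<^sup>2) \<le> real N ^ 3 * B\<^sup>2"
proof -
  let ?h = "mesh L N"
  define g where "g x = (f (x + axis m ?h) - f x) / ?h" for x
  have h: "0 < ?h" "?h \<le> L" using L N by (auto simp: mesh_def field_simps)
  have "continuous_on UNIV (\<lambda>x. f (x + axis m ?h))"
    by (rule continuous_on_compose2[OF cont]) (auto intro!: continuous_intros)
  then have contg: "continuous_on UNIV g"
    unfolding g_def using h by (intro continuous_intros cont) auto
  have bd: "\<bar>g x\<bar> \<le> B" if "x \<in> cell L" for x
    using lip[OF that h, of m] h by (simp add: g_def field_simps)
  have "(fourier_proj L K f (x + axis m ?h) - fourier_proj L K f x) / of_real ?h
      = fourier_proj L K g x" for x
    unfolding g_def by (rule fourier_proj_difference_quotient[OF L cont per h, symmetric])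
  then have "period_sum N (\<lambda>i j k. (cmod ((fourier_proj L K f (cell_center L N i j k + axis m ?h)
      - fourier_proj L K f (cell_center L N i j k)) / of_real ?h))\<^sup>2)
     = real N ^ 3 * (\<Sum>k\<in>modes_upto K. (cmod (mode_coeff L g k))\<^sup>2)"
    by (simp only: period_sum_def node_sum_fourier_proj[OF L N])
  also have "\<dots> \<le> real N ^ 3 * B\<^sup>2"
    by (intro mult_left_mono bessel_inequality[OF L contg bd]) auto
  finally show ?thesis .
qed

lemma fourier_initial_gradient_bound:
  assumes L: "L > 0" and cont: "continuous_on UNIV f"
    and per: "L_periodic L f"
    and lip: "\<And>x s i. x \<in> cell L \<Longrightarrow> 0 < s \<Longrightarrow> s \<le> L \<Longrightarrow> \<bar>f (x + axis i s) - f x\<bar> \<le> B * s"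
    and init: "fourier_initial L N f u"
  shows "grad_norm_sq L N u \<le> 3 * L ^ 3 * B\<^sup>2"
proof -
  let ?h = "mesh L N"
  obtain K where N: "N = 2 * K + 1"
    and u: "\<And>i j k. of_real (u i j k) = fourier_proj L K f (cell_center L N i j k)"
    using init by (auto simp: fourier_initial_def)
  note le = node_sum_projected_difference_le[OF L N cont per lip]
  have real_quot: "((x - y) / ?h)\<^sup>2 = (cmod ((of_real x - of_real y) / of_real ?h))\<^sup>2" for x y
    by (simp only: of_real_diff[symmetric] of_real_divide[symmetric] norm_of_real power2_abs)
  have "period_sum N (\<lambda>i j k. ((u (i + 1) j k - u i j k) / ?h)\<^sup>2) \<le> real N ^ 3 * B\<^sup>2"
    "period_sum N (\<lambda>i j k. ((u i (j + 1) k - u i j k) / ?h)\<^sup>2) \<le> real N ^ 3 * B\<^sup>2"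
    "period_sum N (\<lambda>i j k. ((u i j (k + 1) - u i j k) / ?h)\<^sup>2) \<le> real N ^ 3 * B\<^sup>2"
    unfolding real_quot u cell_center_shift by (rule le; assumption)+
  then have "period_sum N (\<lambda>i j k. ((u (i + 1) j k - u i j k) / ?h)\<^sup>2
      + ((u i (j + 1) k - u i j k) / ?h)\<^sup>2 + ((u i j (k + 1) - u i j k) / ?h)\<^sup>2)
      \<le> 3 * (real N ^ 3 * B\<^sup>2)"
    by (simp add: period_sum_add)
  then have "?h ^ 3 * period_sum N (\<lambda>i j k. ((u (i + 1) j k - u i j k) / ?h)\<^sup>2
      + ((u i (j + 1) k - u i j k) / ?h)\<^sup>2 + ((u i j (k + 1) - u i j k) / ?h)\<^sup>2)
      \<le> ?h ^ 3 * (3 * (real N ^ 3 * B\<^sup>2))"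
    using L by (intro mult_left_mono) (auto simp: mesh_def)
  also have "\<dots> = 3 * (real N * ?h) ^ 3 * B\<^sup>2"
    by (simp add: power_mult_distrib)
  also have "real N * ?h = L" using N by (simp add: mesh_def)
  finally show ?thesis
    by (simp add: grad_norm_sq_def grad_h_def period_sum_def)
qed

section \<open>The energy law\<close>

lemma G_entropy_le:
  assumes "\<bar>x\<bar> < 1"
  shows "G (1 + x) \<le> 2"
proof -
  have "(1 + x) * ln (1 + x) \<le> (1 + x) * 1"
    using assms ln_le_minus_one[of "1 + x"] by (intro mult_left_mono) linarith+
  then show ?thesis using assms by (simp add: G_def)
qed

lemma mesh_cube: "N > 0 \<Longrightarrow> mesh L N ^ 3 * (real N ^ 3 * c) = L ^ 3 * c"
  by (simp add: mesh_def power_divide)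

text \<open>
  Every part of the energy except the gradient is controlled by \<open>\<bar>u\<bar> < 1\<close> alone: each of the two entropy
  densities is at most \<open>2\<close>, the concave term is nonpositive, and the nonlocal term is bounded through
  \<open>norm_minus1_sq_le\<close> by \<open>\<parallel>u\<parallel>\<^sup>2 \<le> L\<^sup>3\<close>, since removing the mean does not increase the norm.
\<close>

lemma energy_le_of_gradient_bound:
  assumes "L > 0" "N > 0" "\<theta> > 0" "\<sigma> \<ge> 0" and per: "u \<in> V_per N"
    and bd: "\<And>i j k. \<bar>u i j k\<bar> < 1" and grad: "grad_norm_sq L N u \<le> R"
  shows "energy L N \<theta> \<epsilon> \<sigma> u \<le> 4 * L ^ 3 + \<epsilon>\<^sup>2 / 2 * R + 3 * \<sigma> * L ^ 5"
proof -
  have H: "mesh L N ^ 3 \<ge> 0" using mesh_pos[OF assms(1,2)] by simp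
  have scale: "mesh L N ^ 3 * period_sum N v \<le> L ^ 3 * c" if "\<And>i j k. v i j k \<le> c" for v c
  proof -
    have "period_sum N v \<le> period_sum N (\<lambda>i j k. c)" using that by (intro period_sum_mono)
    then have "mesh L N ^ 3 * period_sum N v \<le> mesh L N ^ 3 * (real N ^ 3 * c)"
      using H by (intro mult_left_mono) (simp_all add: period_sum_const)
    then show ?thesis by (simp add: mesh_cube[OF assms(2)])
  qed
  have "G (1 + u i j k) + G (1 - u i j k) \<le> 4" for i j k
    using G_entropy_le[OF bd, of i j k] G_entropy_le[of "- u i j k"] bd[of i j k] by simp
  then have ent: "mesh L N ^ 3 * period_sum N (\<lambda>i j k. G (1 + u i j k) + G (1 - u i j k)) \<le> L ^ 3 * 4"
    by (rule scale)
  let ?m = "grid_mean L N u"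
  have "norm2_sq L N (demean L N u)
      = norm2_sq L N u - mesh L N ^ 3 * (2 * ?m * period_sum N u - real N ^ 3 * ?m\<^sup>2)"
  proof -
    have sq: "(u i j k - ?m)\<^sup>2 = ((u i j k)\<^sup>2 - (2 * ?m) * u i j k) + ?m\<^sup>2" for i j k
      by (simp add: power2_eq_square algebra_simps)
    have "period_sum N (\<lambda>i j k. (u i j k - ?m)\<^sup>2)
        = (period_sum N (\<lambda>i j k. (u i j k)\<^sup>2) - (2 * ?m) * period_sum N u) + real N ^ 3 * ?m\<^sup>2"
      unfolding sq period_sum_add period_sum_diff period_sum_cmult period_sum_const ..
    then show ?thesis
      unfolding norm2_sq_eq demean_def by (simp only:) (simp add: algebra_simps)
  qed
  also have "mesh L N ^ 3 * (2 * ?m * period_sum N u - real N ^ 3 * ?m\<^sup>2) = L ^ 3 * ?m\<^sup>2"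
  proof -
    have "mesh L N ^ 3 * period_sum N u = L ^ 3 * ?m"
      using assms(1) by (simp add: grid_mean_eq)
    moreover have "mesh L N ^ 3 * (real N ^ 3 * ?m\<^sup>2) = L ^ 3 * ?m\<^sup>2"
      by (rule mesh_cube[OF assms(2)])
    ultimately show ?thesis
      by (auto simp: right_diff_distrib power2_eq_square mult.left_commute[of _ "2 * ?m"])
  qed
  also have "norm2_sq L N u - L ^ 3 * ?m\<^sup>2 \<le> norm2_sq L N u" using assms(1) by simp
  also have "norm2_sq L N u \<le> L ^ 3 * 1"
  proof -
    have "(u i j k)\<^sup>2 \<le> 1" for i j k
      using bd[of i j k] by (simp add: abs_square_le_1 less_imp_le)
    then show ?thesis unfolding norm2_sq_eq by (rule scale)
  qed
  finally have dm: "norm2_sq L N (demean L N u) \<le> L ^ 3" by simp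
  have "norm_minus1_sq L N (demean L N u) \<le> 3/2 * L\<^sup>2 * norm2_sq L N (demean L N u)"
    by (rule norm_minus1_sq_le[OF assms(1,2) demean_V0[OF assms(1,2) per]])
  also have "\<dots> \<le> 3/2 * L\<^sup>2 * L ^ 3" using dm by (intro mult_left_mono) auto
  finally have "\<sigma> / 2 * norm_minus1_sq L N (demean L N u) \<le> \<sigma> / 2 * (3/2 * L\<^sup>2 * L ^ 3)"
    using assms(4) by (intro mult_left_mono) auto
  also have "\<dots> \<le> 3 * \<sigma> * L ^ 5"
    using assms(1,4) by (simp add: power_numeral_reduce)
  finally have nl: "\<sigma> / 2 * norm_minus1_sq L N (demean L N u) \<le> 3 * \<sigma> * L ^ 5" .
  have gr: "\<epsilon>\<^sup>2 / 2 * grad_norm_sq L N u \<le> \<epsilon>\<^sup>2 / 2 * R"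
    using grad by (intro mult_left_mono) auto
  have "\<theta> / 2 * norm2_sq L N u \<ge> 0" using assms(3) norm2_sq_nonneg[OF assms(1)] by simp
  with ent nl gr show ?thesis unfolding energy_eq by simp
qed

lemma energy_le_mod_energy:
  "L > 0 \<Longrightarrow> \<theta> > 0 \<Longrightarrow> energy L N \<theta> \<epsilon> \<sigma> u \<le> mod_energy L N \<theta> \<epsilon> \<sigma> u v"
  by (simp add: mod_energy_def norm2_sq_nonneg grad_norm_sq_nonneg)

lemma mod_energy_same: "mod_energy L N \<theta> \<epsilon> \<sigma> u u = energy L N \<theta> \<epsilon> \<sigma> u"
  by (simp add: mod_energy_def norm2_sq_def grid_inner_def grad_norm_sq_def grad_h_def)

theorem theorem3p2:
  fixes L \<theta>\<^sub>0 \<epsilon> \<sigma> :: real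
    and M :: "real \<Rightarrow> real"
    and \<Phi>\<^sub>0 :: "real ^ 3 \<Rightarrow> real"
  assumes "L > 0" and "\<theta>\<^sub>0 > 0" and "\<epsilon> > 0" and "\<sigma> \<ge> 0"
    and "\<forall>x\<in>{-1..1}. M x > 0"
    and "C_diff 6 \<Phi>\<^sub>0" and "L_periodic L \<Phi>\<^sub>0"
  shows "\<exists>C\<^sub>3>0. \<forall>N>0. \<forall>\<tau>>0. \<forall>\<phi> :: int \<Rightarrow> grid.
    scheme_solution L N \<theta>\<^sub>0 \<epsilon> \<sigma> M \<tau> \<phi> \<longrightarrow>
      (\<forall>n\<ge>0. mod_energy L N \<theta>\<^sub>0 \<epsilon> \<sigma> (\<phi> (n + 1)) (\<phi> n)
              \<le> mod_energy L N \<theta>\<^sub>0 \<epsilon> \<sigma> (\<phi> n) (\<phi> (n - 1))) \<and>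
      (\<forall>m\<ge>0.
         energy L N \<theta>\<^sub>0 \<epsilon> \<sigma> (\<phi> m) \<le> mod_energy L N \<theta>\<^sub>0 \<epsilon> \<sigma> (\<phi> m) (\<phi> (m - 1)) \<and>
         (\<forall>l. 0 \<le> l \<and> l \<le> m \<longrightarrow>
            mod_energy L N \<theta>\<^sub>0 \<epsilon> \<sigma> (\<phi> m) (\<phi> (m - 1))
            \<le> mod_energy L N \<theta>\<^sub>0 \<epsilon> \<sigma> (\<phi> l) (\<phi> (l - 1)))) \<and>
      mod_energy L N \<theta>\<^sub>0 \<epsilon> \<sigma> (\<phi> 0) (\<phi> (-1)) = energy L N \<theta>\<^sub>0 \<epsilon> \<sigma> (\<phi> 0) \<and>
      (fourier_initial L N \<Phi>\<^sub>0 (\<phi> 0) \<longrightarrow>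
         energy L N \<theta>\<^sub>0 \<epsilon> \<sigma> (\<phi> 0) \<le> C\<^sub>3 \<and>
         (\<forall>m\<ge>0. energy L N \<theta>\<^sub>0 \<epsilon> \<sigma> (\<phi> m) \<le> C\<^sub>3))"
proof -
  have cont: "continuous_on UNIV \<Phi>\<^sub>0" using assms(6) by (rule C_diff_imp_continuous)
  have "C_diff (Suc 5) \<Phi>\<^sub>0" using assms(6) by (simp add: eval_nat_numeral)
  then obtain B where lip: "\<And>x s i. x \<in> cell L \<Longrightarrow> 0 < s \<Longrightarrow> s \<le> L
      \<Longrightarrow> \<bar>\<Phi>\<^sub>0 (x + axis i s) - \<Phi>\<^sub>0 x\<bar> \<le> B * s"
    using C_diff_Suc_directional_lipschitz by blast
  define C where "C = 4 * L ^ 3 + \<epsilon>\<^sup>2 / 2 * (3 * L ^ 3 * B\<^sup>2) + 3 * \<sigma> * L ^ 5"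
  have "C > 0" unfolding C_def using assms by (intro add_pos_nonneg) auto
  moreover have "(\<forall>n\<ge>0. mod_energy L N \<theta>\<^sub>0 \<epsilon> \<sigma> (\<phi> (n + 1)) (\<phi> n)
              \<le> mod_energy L N \<theta>\<^sub>0 \<epsilon> \<sigma> (\<phi> n) (\<phi> (n - 1))) \<and>
      (\<forall>m\<ge>0.
         energy L N \<theta>\<^sub>0 \<epsilon> \<sigma> (\<phi> m) \<le> mod_energy L N \<theta>\<^sub>0 \<epsilon> \<sigma> (\<phi> m) (\<phi> (m - 1)) \<and>
         (\<forall>l. 0 \<le> l \<and> l \<le> m \<longrightarrow>
            mod_energy L N \<theta>\<^sub>0 \<epsilon> \<sigma> (\<phi> m) (\<phi> (m - 1))
            \<le> mod_energy L N \<theta>\<^sub>0 \<epsilon> \<sigma> (\<phi> l) (\<phi> (l - 1)))) \<and>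
      mod_energy L N \<theta>\<^sub>0 \<epsilon> \<sigma> (\<phi> 0) (\<phi> (-1)) = energy L N \<theta>\<^sub>0 \<epsilon> \<sigma> (\<phi> 0) \<and>
      (fourier_initial L N \<Phi>\<^sub>0 (\<phi> 0) \<longrightarrow>
         energy L N \<theta>\<^sub>0 \<epsilon> \<sigma> (\<phi> 0) \<le> C \<and>
         (\<forall>m\<ge>0. energy L N \<theta>\<^sub>0 \<epsilon> \<sigma> (\<phi> m) \<le> C))"
    if N: "N > 0" and \<tau>: "\<tau> > 0" and sol: "scheme_solution L N \<theta>\<^sub>0 \<epsilon> \<sigma> M \<tau> \<phi>"
    for N \<tau> and \<phi> :: "int \<Rightarrow> grid"
  proof -
    let ?E = "\<lambda>n. mod_energy L N \<theta>\<^sub>0 \<epsilon> \<sigma> (\<phi> n) (\<phi> (n - 1))"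
    note dissip = scheme_step_dissipates[OF assms(1) N assms(2) \<tau> sol]
    have mono: "?E m \<le> ?E l" if "0 \<le> l" "l \<le> m" for l m
      using that(2)
    proof (induction m rule: int_ge_induct)
      case (step m)
      with dissip[of m] that(1) show ?case by simp
    qed simp
    have below: "energy L N \<theta>\<^sub>0 \<epsilon> \<sigma> (\<phi> m) \<le> ?E m" for m
      using assms(1,2) by (rule energy_le_mod_energy)
    have init: "mod_energy L N \<theta>\<^sub>0 \<epsilon> \<sigma> (\<phi> 0) (\<phi> (-1)) = energy L N \<theta>\<^sub>0 \<epsilon> \<sigma> (\<phi> 0)"
      using sol by (simp add: scheme_solution_def mod_energy_same)
    have dec: "energy L N \<theta>\<^sub>0 \<epsilon> \<sigma> (\<phi> m) \<le> energy L N \<theta>\<^sub>0 \<epsilon> \<sigma> (\<phi> 0)" if "m \<ge> 0" for m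
      using below[of m] mono[of 0 m] that init by simp
    have start: "energy L N \<theta>\<^sub>0 \<epsilon> \<sigma> (\<phi> 0) \<le> C" if F: "fourier_initial L N \<Phi>\<^sub>0 (\<phi> 0)"
    proof -
      have adm: "\<phi> 0 \<in> V_per N" "norm_sup N (\<phi> 0) < 1"
        using sol by (auto simp: scheme_solution_def)
      show ?thesis
        unfolding C_def
        by (rule energy_le_of_gradient_bound[OF assms(1) N assms(2,4) adm(1) norm_sup_less_imp[OF N adm]
              fourier_initial_gradient_bound[OF assms(1) cont assms(7) lip F]])
    qed
    have "energy L N \<theta>\<^sub>0 \<epsilon> \<sigma> (\<phi> m) \<le> C"
      if "fourier_initial L N \<Phi>\<^sub>0 (\<phi> 0)" "m \<ge> 0" for m
      using dec[OF that(2)] start[OF that(1)] by simp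
    with dissip mono below init start show ?thesis by simp
  qed
  ultimately show ?thesis by blast
qed

end
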